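(* Let $(s_0,\ldots,s_{p-1})=\mathcal{N}(\sigma_0,\ldots,\sigma_{p-1})$ be a Nikishin system on the star $\Gamma_0$, and let $(P_{n,k})$ be the associated system of polynomials. Then for each $k=0,\ldots,p-1$ (and each integer $n\ge 0$), the zeros of $P_{n,k}$ and $P_{n+1,k}$ interlace; that is, between two consecutive zeros of $P_{n,k}$ there is exactly one zero of $P_{n+1,k}$, and vice versa.
   Context: Nikishin system. Fix an integer $p\ge 1$. For $0\le j\le p-1$ let $[a_j,b_j]$ be intervals with $0\le a_j<b_j<\infty$ for $j$ even and $-\infty<a_j<b_j\le 0$ for $j$ odd, and let $\Gamma_j=\{z\in\mathbb{C}: z^{p+1}\in[a_j,b_j]\}$. Assume $\Gamma_j\cap\Gamma_{j+1}=\emptyset$ for $0\le j\le p-2$. For each $j$ let $\sigma_j$ be a positive measure on $\Gamma_j$ with infinitely many points in its support, rotationally invariant (invariant under $z\mapsto e^{2\pi i/(p+1)}z$). Define $s_{k,k}=\sigma_k$ and, for $0\le k<j\le p-1$, $ds_{k,j}(z)=\Big(\int_{\Gamma_{k+1}}\frac{ds_{k+1,j}(t)}{z-t}\Big)d\sigma_k(z)$; put $s_j=s_{0,j}$. Then $(s_0,\ldots,s_{p-1})=\mathcal{N}(\sigma_0,\ldots,\sigma_{p-1})$ is the Nikishin system generated by $(\sigma_0,\ldots,\sigma_{p-1})$. Multiple orthogonal polynomials. $Q_n$ ($n\ge0$) is the monic polynomial of lowest degree satisfying $\int_{\Gamma_0}Q_n(z)z^l\,ds_j(z)=0$ for $l=0,\ldots,\lfloor\frac{n-j-1}{p}\rfloor$,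 $0\le j\le p-1$. It is known that $\deg Q_n=n$ and that, if $n\equiv\ell \bmod (p+1)$ with $0\le\ell\le p$, then $Q_n(z)=z^\ell\mathcal{Q}_d(z^{p+1})$ with $\mathcal{Q}_d$ monic of degree $d=\frac{n-\ell}{p+1}$. Functions of the second kind. $\Psi_{n,0}=Q_n$ and $\Psi_{n,k}(z)=\int_{\Gamma_{k-1}}\frac{\Psi_{n,k-1}(t)}{z-t}d\sigma_{k-1}(t)$ for $k=1,\ldots,p$. With $\ell$ the integer determined by $n\equiv\ell \bmod (p+1)$, $0\le\ell\le p$, and $\mathcal{Q}_d$ the monic polynomial of degree $d=\frac{n-\ell}{p+1}$ such that $Q_n(z)=z^\ell\mathcal{Q}_d(z^{p+1})$, put $\psi_{n,0}=\mathcal{Q}_d$ and, for $1\le k\le p$, $z\in\mathbb{C}\setminus[a_{k-1},b_{k-1}]$: $\psi_{n,k}(z)=z\int_{\Gamma_{k-1}}\frac{\Psi_{n,k-1}(t)\,t^{k-1-\ell}}{z-t^{p+1}}d\sigma_{k-1}(t)$ if $\ell<k$, and $\psi_{n,k}(z)=\int_{\Gamma_{k-1}}\frac{\Psi_{n,k-1}(t)\,t^{p+k-\ell}}{z-t^{p+1}}d\sigma_{k-1}(t)$ if $k\le\ell$. Polynomials $P_{n,k}$. It is known that for $0\le k\le p-1$ the function $\psi_{n,k}$ has finitely many zeros in $(a_k,b_k)$, all simple. $P_{n,k}$ denotes the monic polynomial whose zeros are the zeros of $\psi_{n,k}$ in $(a_k,b_k)$ (all simple). *)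

theory Defs
  imports "HOL-Analysis.Analysis" "HOL-Computational_Algebra.Polynomial"
begin

definition star :: "nat \<Rightarrow> real \<Rightarrow> real \<Rightarrow> complex set" where
  "star p \<alpha> \<beta> = {z. z ^ (p + 1) \<in> complex_of_real ` {\<alpha>..\<beta>}}"

definition msupport :: "'a::topological_space measure \<Rightarrow> 'a set" where
  "msupport M = {x. \<forall>U. open U \<longrightarrow> x \<in> U \<longrightarrow> emeasure M U > 0}"

text \<open>A positive measure on a star is rendered as a finite Borel measure on the whole plane for
  which the complement of the star is a null set. Hence integrals over the star are written below
  as integrals over the whole plane.\<close>

definition star_measure :: "nat \<Rightarrow> real \<Rightarrow> real \<Rightarrow> complex measure \<Rightarrow> bool" where
  "star_measure p \<alpha> \<beta> \<mu> \<longleftrightarrow>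
     sets \<mu> = sets borel \<and> finite_measure \<mu> \<and>
     emeasure \<mu> (- star p \<alpha> \<beta>) = 0 \<and>
     infinite (msupport \<mu>) \<and>
     distr \<mu> borel (\<lambda>z. cis (2 * pi / real (p + 1)) * z) = \<mu>"

definition nikishin_generators ::
  "nat \<Rightarrow> (nat \<Rightarrow> real) \<Rightarrow> (nat \<Rightarrow> real) \<Rightarrow> (nat \<Rightarrow> complex measure) \<Rightarrow> bool" where
  "nikishin_generators p a b \<sigma> \<longleftrightarrow>
     (\<forall>j<p. a j < b j \<and> (even j \<longrightarrow> 0 \<le> a j) \<and> (odd j \<longrightarrow> b j \<le> 0)) \<and>
     (\<forall>j. j + 1 < p \<longrightarrow> star p (a j) (b j) \<inter> star p (a (j + 1)) (b (j + 1)) = {}) \<and>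
     (\<forall>j<p. star_measure p (a j) (b j) (\<sigma> j))"

text \<open>The complex measure \<open>s\<^sub>k\<^sub>,\<^sub>j\<close> (for \<open>k \<le> j\<close>) is represented by its integration functional:
  \<open>nikishin_int \<sigma> k j f\<close> is the integral of \<open>f\<close> with respect to \<open>s\<^sub>k\<^sub>,\<^sub>j\<close>. The recursion says that
  \<open>s\<^sub>k\<^sub>,\<^sub>j\<close> has, with respect to \<open>\<sigma> k\<close>, the density given by the Cauchy transform of
  \<open>s\<^sub>k\<^sub>+\<^sub>1\<^sub>,\<^sub>j\<close>. Only the values with \<open>k \<le> j\<close> are meaningful.\<close>

function nikishin_int ::
  "(nat \<Rightarrow> complex measure) \<Rightarrow> nat \<Rightarrow> nat \<Rightarrow> (complex \<Rightarrow> complex) \<Rightarrow> complex" where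
  "nikishin_int \<sigma> k j f =
     (if k < j then \<integral>z. f z * nikishin_int \<sigma> (k + 1) j (\<lambda>t. 1 / (z - t)) \<partial>\<sigma> k
      else \<integral>z. f z \<partial>\<sigma> k)"
  by pat_completeness auto
termination
  by (relation "Wellfounded.measure (\<lambda>(\<sigma>, k, j, f). j - k)") auto

declare nikishin_int.simps [simp del]

text \<open>For \<open>n \<le> j\<close> the upper bound on \<open>l\<close> is \<open>-1\<close>, so there is no condition with that \<open>j\<close>.\<close>

definition multiple_orthogonal ::
  "nat \<Rightarrow> (nat \<Rightarrow> complex measure) \<Rightarrow> nat \<Rightarrow> complex poly \<Rightarrow> bool" where
  "multiple_orthogonal p \<sigma> n Q \<longleftrightarrow>
     (\<forall>j<p. \<forall>l::nat. int l \<le> (int n - int j - 1) div int p \<longrightarrow>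
        nikishin_int \<sigma> 0 j (\<lambda>z. poly Q z * z ^ l) = 0)"

definition mop :: "nat \<Rightarrow> (nat \<Rightarrow> complex measure) \<Rightarrow> nat \<Rightarrow> complex poly" where
  "mop p \<sigma> n =
     (THE Q. is_arg_min degree (\<lambda>R. lead_coeff R = 1 \<and> multiple_orthogonal p \<sigma> n R) Q)"

definition reduced_mop :: "nat \<Rightarrow> (nat \<Rightarrow> complex measure) \<Rightarrow> nat \<Rightarrow> complex poly" where
  "reduced_mop p \<sigma> n =
     (THE q. lead_coeff q = 1 \<and> degree q = n div (p + 1) \<and>
        (\<forall>z. poly (mop p \<sigma> n) z = z ^ (n mod (p + 1)) * poly q (z ^ (p + 1))))"

primrec second_kind ::
  "nat \<Rightarrow> (nat \<Rightarrow> complex measure) \<Rightarrow> nat \<Rightarrow> nat \<Rightarrow> complex \<Rightarrow> complex" where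
  "second_kind p \<sigma> n 0 = (\<lambda>z. poly (mop p \<sigma> n) z)"
| "second_kind p \<sigma> n (Suc k) = (\<lambda>z. \<integral>t. second_kind p \<sigma> n k t / (z - t) \<partial>\<sigma> k)"

text \<open>In both branches of the following definition the exponent of \<open>t\<close> is a nonnegative integer
  (for \<open>1 \<le> k \<le> p\<close>), so the truncated subtraction is harmless.\<close>

definition reduced_second_kind ::
  "nat \<Rightarrow> (nat \<Rightarrow> complex measure) \<Rightarrow> nat \<Rightarrow> nat \<Rightarrow> complex \<Rightarrow> complex" where
  "reduced_second_kind p \<sigma> n k z =
     (let l = n mod (p + 1) in
      if k = 0 then poly (reduced_mop p \<sigma> n) z
      else if l < k then
        z * (\<integral>t. second_kind p \<sigma> n (k - 1) t * t ^ (k - 1 - l) / (z - t ^ (p + 1)) \<partial>\<sigma> (k - 1))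
      else
        (\<integral>t. second_kind p \<sigma> n (k - 1) t * t ^ (p + k - l) / (z - t ^ (p + 1)) \<partial>\<sigma> (k - 1)))"

text \<open>The index set of the product is finite for a Nikishin system, so the convention that a product
  over an infinite set is \<open>1\<close> plays no role.\<close>

definition zero_poly ::
  "nat \<Rightarrow> (nat \<Rightarrow> real) \<Rightarrow> (nat \<Rightarrow> real) \<Rightarrow> (nat \<Rightarrow> complex measure) \<Rightarrow> nat \<Rightarrow> nat \<Rightarrow> real poly"
  where
  "zero_poly p a b \<sigma> n k =
     (\<Prod>x | a k < x \<and> x < b k \<and> reduced_second_kind p \<sigma> n k (complex_of_real x) = 0. [:- x, 1:])"

definition consecutive_zeros :: "real poly \<Rightarrow> real \<Rightarrow> real \<Rightarrow> bool" where
  "consecutive_zeros P x y \<longleftrightarrow>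
     x < y \<and> poly P x = 0 \<and> poly P y = 0 \<and> (\<forall>z. x < z \<and> z < y \<longrightarrow> poly P z \<noteq> 0)"

definition zeros_interlace :: "real poly \<Rightarrow> real poly \<Rightarrow> bool" where
  "zeros_interlace P R \<longleftrightarrow>
     (\<forall>x y. consecutive_zeros P x y \<longrightarrow> (\<exists>!z. x < z \<and> z < y \<and> poly R z = 0)) \<and>
     (\<forall>x y. consecutive_zeros R x y \<longrightarrow> (\<exists>!z. x < z \<and> z < y \<and> poly P z = 0))"

end

theory Submission
  imports Defs
begin

text \<open>In the variable \<open>x = z\<^sup>p\<^sup>+\<^sup>1\<close> the whole construction becomes real. Rotation invariance kills every
integral of a power of \<open>z\<close> whose exponent is not a multiple of \<open>p + 1\<close>, so the measures on the
stars may be replaced by their images \<open>\<nu> k\<close> on the intervals \<open>[a k, b k]\<close>, and \<open>\<psi>\<^sub>n\<^sub>,\<^sub>k\<close> becomes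
the function \<open>psi l q k\<close> on the line, where \<open>l = n mod (p + 1)\<close> and \<open>q\<close> is the reduced orthogonal
polynomial, of degree \<open>d = n div (p + 1)\<close>. If the products of the powers \<open>x\<^sup>s\<close> with the weights
\<open>w\<^sub>j\<close> of the system (\<open>j < p\<close>) are numbered by \<open>m = j + p s\<close>, then the orthogonality conditions on
\<open>q\<close> are exactly those with \<open>m\<close> in the window \<open>[l, l + d)\<close>.

Zeros are counted by passing between consecutive levels. Fubini's theorem turns the conditions on
\<open>q\<close> into conditions on each \<open>psi l q k\<close> (\<open>orth_level\<close>); let \<open>M\<^sub>k\<close> be the number of \<open>m\<close> in the window
with \<open>m mod p = k\<close>. Each of them says that one moment of a density \<open>g\<^sub>k\<close> vanishes, where \<open>g\<^sub>k\<close> is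
\<open>psi l q k\<close> up to a factor \<open>x\<close> and has \<open>psi l q (k + 1)\<close>, again up to a factor \<open>x\<close>, as its Cauchy
transform. Every zero of that transform is one more relation for \<open>g\<^sub>k\<close>, now against a rational
function with a pole at the zero. Partial fractions combine all relations, and the usual
sign argument yields: \<open>N\<close> zeros of \<open>psi l q (k + 1)\<close>, with multiplicity, force at least \<open>N + M\<^sub>k\<close>
sign changes of \<open>psi l q k\<close> (\<open>sign_changes_from_poles\<close>). Starting at the last level one finds at least
\<open>M\<^sub>k + \<dots> + M\<^sub>p\<^sub>-\<^sub>1\<close> sign changes at level \<open>k\<close>; starting at level \<open>0\<close>, where \<open>q\<close> has at most
\<open>degree q\<close> zeros, one finds at most \<open>degree q - (M\<^sub>0 + \<dots> + M\<^sub>k\<^sub>-\<^sub>1)\<close> zeros. For a window of length \<open>D\<close> the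
two bounds differ by \<open>degree q - D\<close>. So \<open>degree q < D\<close> is impossible for \<open>q \<noteq> 0\<close>, which gives the normality of
all indices, and for \<open>degree q \<le> D + 1\<close> all zeros are simple (\<open>simple_zeros\<close>), because a multiple zero
would exceed the number of sign changes by two.

For interlacing, the functions belonging to \<open>n\<close> and \<open>n + 1\<close> are put into one family with a common
\<open>l\<close>. If \<open>l < p\<close> and \<open>d > 0\<close>, then the index \<open>l\<close> of the function for \<open>n\<close> can be raised by one
(\<open>psi_shift\<close>), while for \<open>d = 0\<close> there are no zeros; if
\<open>l = p\<close>, then multiplication of \<open>q\<close> by the variable changes the index from \<open>p\<close> to \<open>0\<close>
(\<open>psi_times_variable\<close>). Both polynomials are then orthogonal on a common window whose length is one
less than their degree, and so are all their linear combinations. Hence every nonzero member of the pencil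
spanned by the two functions has only simple zeros, and Rolle's theorem for their quotient puts a
zero of each between any two zeros of the other (\<open>zero_between_zeros_of_simple_pencil\<close>).\<close>

section \<open>Sign changes and pencils of functions\<close>

text \<open>Both sides carry strict signs, so a sign change is isolated among the zeros of \<open>f\<close>.\<close>

definition sign_change :: "(real \<Rightarrow> real) \<Rightarrow> real \<Rightarrow> bool" where
  "sign_change f c \<longleftrightarrow>
     (\<exists>\<delta>>0. \<forall>x y. c - \<delta> < x \<and> x < c \<and> c < y \<and> y < c + \<delta> \<longrightarrow> f x * f y < 0)"

lemma isCont_same_sign_nhd:
  fixes f :: "real \<Rightarrow> real"
  assumes "isCont f c" "f c \<noteq> 0"
  obtains \<delta> where "\<delta> > 0" "\<And>x. \<bar>x - c\<bar> < \<delta> \<Longrightarrow> f x * f c > 0"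
proof -
  obtain \<delta> where \<delta>: "\<delta> > 0" "\<And>x. \<bar>x - c\<bar> < \<delta> \<Longrightarrow> \<bar>f x - f c\<bar> < \<bar>f c\<bar>"
    using assms unfolding continuous_at_eps_delta dist_real_def
    by (meson zero_less_abs_iff)
  have "f x * f c > 0" if "\<bar>x - c\<bar> < \<delta>" for x
  proof (cases "f c > 0")
    case True
    then show ?thesis using \<delta>(2)[OF that] by (auto intro: mult_pos_pos)
  next
    case False
    then have "f x < 0" "f c < 0" using \<delta>(2)[OF that] assms(2) by auto
    then show ?thesis by (simp add: mult_neg_neg)
  qed
  then show ?thesis using that \<delta>(1) by blast
qed

lemma sign_change_imp_zero:
  assumes "isCont f c" "sign_change f c"
  shows "f c = 0"
proof (rule ccontr)
  assume "f c \<noteq> 0"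
  then obtain \<delta> where \<delta>: "\<delta> > 0" "\<And>x. \<bar>x - c\<bar> < \<delta> \<Longrightarrow> f x * f c > 0"
    using isCont_same_sign_nhd assms(1) by metis
  obtain e where e: "e > 0" "\<And>x y. c - e < x \<Longrightarrow> x < c \<Longrightarrow> c < y \<Longrightarrow> y < c + e \<Longrightarrow> f x * f y < 0"
    using assms(2) unfolding sign_change_def by blast
  define h where "h = min \<delta> e / 2"
  have h: "0 < h" "h < \<delta>" "h < e" using \<delta>(1) e(1) by (auto simp: h_def)
  have "f (c - h) * f (c + h) < 0" using h by (intro e(2)) auto
  moreover have "f (c - h) * f c > 0" "f (c + h) * f c > 0" using h by (auto intro: \<delta>(2))
  ultimately show False
    by (smt (verit) mult_neg_neg mult_pos_pos zero_less_mult_iff mult_less_0_iff)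
qed

lemma sign_change_mult_iff:
  assumes "isCont g c" "g c \<noteq> 0"
  shows "sign_change (\<lambda>x. f x * g x) c \<longleftrightarrow> sign_change f c"
proof -
  obtain \<delta> where \<delta>: "\<delta> > 0" "\<And>x. \<bar>x - c\<bar> < \<delta> \<Longrightarrow> g x * g c > 0"
    using isCont_same_sign_nhd assms by metis
  have pos: "g x * g y > 0" if "\<bar>x - c\<bar> < \<delta>" "\<bar>y - c\<bar> < \<delta>" for x y
    using \<delta>(2)[OF that(1)] \<delta>(2)[OF that(2)] by (smt (verit) zero_less_mult_iff)
  have eq: "(f x * g x) * (f y * g y) < 0 \<longleftrightarrow> f x * f y < 0"
    if "\<bar>x - c\<bar> < \<delta>" "\<bar>y - c\<bar> < \<delta>" for x y
  proof -
    have "(f x * g x) * (f y * g y) = (f x * f y) * (g x * g y)" by (simp add: ac_simps)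
    then show ?thesis using pos[OF that]
      by (metis mult_neg_pos mult_pos_pos mult_zero_left not_less_iff_gr_or_eq)
  qed
  show ?thesis
  proof
    assume "sign_change (\<lambda>x. f x * g x) c"
    then obtain e where e: "e > 0" "\<And>x y. c - e < x \<Longrightarrow> x < c \<Longrightarrow> c < y \<Longrightarrow> y < c + e \<Longrightarrow>
        (f x * g x) * (f y * g y) < 0"
      unfolding sign_change_def by blast
    show "sign_change f c"
      unfolding sign_change_def
    proof (intro exI[of _ "min e \<delta>"] conjI allI impI)
      fix x y assume "c - min e \<delta> < x \<and> x < c \<and> c < y \<and> y < c + min e \<delta>"
      then show "f x * f y < 0" using e(2)[of x y] eq[of x y] by auto
    qed (use e \<delta> in auto)
  next
    assume "sign_change f c"
    then obtain e where e: "e > 0" "\<And>x y. c - e < x \<Longrightarrow> x < c \<Longrightarrow> c < y \<Longrightarrow> y < c + e \<Longrightarrow> f x * f y < 0"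
      unfolding sign_change_def by blast
    show "sign_change (\<lambda>x. f x * g x) c"
      unfolding sign_change_def
    proof (intro exI[of _ "min e \<delta>"] conjI allI impI)
      fix x y assume "c - min e \<delta> < x \<and> x < c \<and> c < y \<and> y < c + min e \<delta>"
      then show "(f x * g x) * (f y * g y) < 0" using e(2)[of x y] eq[of x y] by auto
    qed (use e \<delta> in auto)
  qed
qed

text \<open>With one such factor for each sign change of a function, no sign change is left.\<close>

lemma sign_change_mult_linear:
  assumes "sign_change f c"
  shows "\<not> sign_change (\<lambda>x. f x * (x - c)) c"
proof
  assume "sign_change (\<lambda>x. f x * (x - c)) c"
  then obtain e where e: "e > 0" "\<And>x y. c - e < x \<Longrightarrow> x < c \<Longrightarrow> c < y \<Longrightarrow> y < c + e \<Longrightarrow>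
      (f x * (x - c)) * (f y * (y - c)) < 0"
    unfolding sign_change_def by blast
  obtain d where d: "d > 0" "\<And>x y. c - d < x \<Longrightarrow> x < c \<Longrightarrow> c < y \<Longrightarrow> y < c + d \<Longrightarrow> f x * f y < 0"
    using assms unfolding sign_change_def by blast
  define h where "h = min d e / 2"
  have h: "0 < h" "h < d" "h < e" using d(1) e(1) by (auto simp: h_def)
  have "(f (c - h) * (c - h - c)) * (f (c + h) * (c + h - c)) < 0"
    using h by (intro e(2)) auto
  also have "(f (c - h) * (c - h - c)) * (f (c + h) * (c + h - c)) = - (h * h * (f (c - h) * f (c + h)))"
    by simp
  finally have "h * h * (f (c - h) * f (c + h)) > 0" by simp
  moreover have "f (c - h) * f (c + h) < 0" using h by (intro d(2)) auto
  moreover have "h * h > 0" using h by simp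
  ultimately show False by (metis mult_pos_neg not_less_iff_gr_or_eq)
qed

lemma same_sign_on_zero_free_interval:
  fixes f :: "real \<Rightarrow> real"
  assumes "continuous_on {x..y} f" "\<And>t. t \<in> {x..y} \<Longrightarrow> f t \<noteq> 0" "x \<le> y"
  shows "f x * f y > 0"
proof (rule ccontr)
  assume "\<not> f x * f y > 0"
  then have "f x \<le> 0 \<and> 0 \<le> f y \<or> f y \<le> 0 \<and> 0 \<le> f x"
    by (auto simp: zero_less_mult_iff not_less)
  then obtain t where "t \<in> {x..y}" "f t = 0"
    using IVT'[of f x 0 y] IVT2'[of f y 0 x] assms by auto
  then show False using assms(2) by blast
qed

text \<open>Induction on the number of zeros. The intermediate value theorem provides a zero; if \<open>f\<close> does not
change sign there, then it has the same sign on both sides of it, so on one of the two sides the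
end values still have opposite signs, and that side contains fewer zeros.\<close>

lemma exists_sign_change_between:
  assumes "continuous_on {x1..x2} f" "finite {x \<in> {x1..x2}. f x = 0}" "f x1 * f x2 < 0" "x1 < x2"
  shows "\<exists>c. x1 < c \<and> c < x2 \<and> sign_change f c"
  using assms
proof (induction "card {x \<in> {x1..x2}. f x = 0}" arbitrary: x1 x2 rule: less_induct)
  case less
  note cont = less.prems(1) and fin = less.prems(2)
  have nz: "f x1 \<noteq> 0" "f x2 \<noteq> 0" using less.prems(3) by auto
  obtain c where c: "c \<in> {x1..x2}" "f c = 0"
    using same_sign_on_zero_free_interval[OF cont _ ] less.prems by force
  have c12: "x1 < c" "c < x2" using c nz by (auto simp: less_le)
  define Z where "Z = {x \<in> {x1..x2}. f x = 0} - {c}"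
  have "finite Z" using fin by (simp add: Z_def)
  then obtain d0 where d0: "d0 > 0" "\<And>z. z \<in> Z \<Longrightarrow> d0 \<le> \<bar>z - c\<bar>"
    using finite_set_avoid[of Z c] by (auto simp: Z_def dist_real_def abs_minus_commute)
  define d where "d = min d0 (min (c - x1) (x2 - c))"
  have d: "d > 0" "d \<le> c - x1" "d \<le> x2 - c" "d \<le> d0" using d0 c12 by (auto simp: d_def)
  have nz': "f x \<noteq> 0" if "c - d < x" "x < c + d" "x \<noteq> c" for x
  proof
    assume "f x = 0"
    then have "x \<in> Z" using that d by (auto simp: Z_def)
    then show False using d0(2) that d by force
  qed
  have L: "f x * f y > 0" if "c - d < x" "x \<le> y" "y < c" for x y
    using that d nz' by (intro same_sign_on_zero_free_interval continuous_on_subset[OF cont]) auto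
  have R: "f x * f y > 0" if "c < x" "x \<le> y" "y < c + d" for x y
    using that d nz' by (intro same_sign_on_zero_free_interval continuous_on_subset[OF cont]) auto
  have L': "f x * f (c - d/2) > 0" if "c - d < x" "x < c" for x
    using L[of x "c - d/2"] L[of "c - d/2" x] that d(1)
    by (cases "x \<le> c - d/2") (auto simp: mult.commute)
  have R': "f y * f (c + d/2) > 0" if "c < y" "y < c + d" for y
    using R[of y "c + d/2"] R[of "c + d/2" y] that d(1)
    by (cases "y \<le> c + d/2") (auto simp: mult.commute)
  have nzm: "f (c - d/2) \<noteq> 0" "f (c + d/2) \<noteq> 0" using nz' d(1) by auto
  show ?case
  proof (cases "f (c - d/2) * f (c + d/2) < 0")
    case True
    have "sign_change f c"
      unfolding sign_change_def
    proof (intro exI[of _ d] conjI allI impI)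
      fix x y assume "c - d < x \<and> x < c \<and> c < y \<and> y < c + d"
      then have "f x * f (c - d/2) > 0" "f y * f (c + d/2) > 0" using L' R' by auto
      then show "f x * f y < 0" using True
        by (auto simp: zero_less_mult_iff mult_less_0_iff)
    qed (use d in auto)
    then show ?thesis using c12 by blast
  next
    case False
    then have same: "f (c - d/2) * f (c + d/2) > 0" using nzm
      by (smt (verit) mult_eq_0_iff)
    have psub: "card {x \<in> {u..v}. f x = 0} < card {x \<in> {x1..x2}. f x = 0}"
      if "x1 \<le> u" "v \<le> x2" "c \<notin> {u..v}" for u v
      using that c fin by (intro psubset_card_mono) auto
    consider "f x1 * f (c - d/2) < 0" | "f (c + d/2) * f x2 < 0"
      using same less.prems(3) by (auto simp: zero_less_mult_iff mult_less_0_iff)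
    then show ?thesis
    proof cases
      case 1
      have "\<exists>e>x1. e < c - d/2 \<and> sign_change f e"
        by (rule less.hyps[OF psub])
          (use d c12 1 cont fin in \<open>auto intro: continuous_on_subset finite_subset[OF _ fin]\<close>)
      then show ?thesis using d by force
    next
      case 2
      have "\<exists>e>c + d/2. e < x2 \<and> sign_change f e"
        by (rule less.hyps[OF psub])
          (use d c12 2 cont fin in \<open>auto intro: continuous_on_subset finite_subset[OF _ fin]\<close>)
      then show ?thesis using d c12 by force
    qed
  qed
qed

lemma constant_sign_if_no_sign_change:
  assumes "continuous_on {a<..<b} f" "finite {x \<in> {a<..<b}. f x = 0}"
    and "\<And>c. c \<in> {a<..<b} \<Longrightarrow> \<not> sign_change f c"
  shows "(\<forall>x\<in>{a<..<b}. f x \<ge> 0) \<or> (\<forall>x\<in>{a<..<b}. f x \<le> 0)"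
proof (rule ccontr)
  assume "\<not> ?thesis"
  then obtain x y where xy: "x \<in> {a<..<b}" "y \<in> {a<..<b}" "f x < 0" "f y > 0"
    by (auto simp: not_le)
  have *: False if "x \<in> {a<..<b}" "y \<in> {a<..<b}" "f x * f y < 0" "x < y" for x y
  proof -
    have "\<exists>c. x < c \<and> c < y \<and> sign_change f c"
      by (rule exists_sign_change_between)
        (use that in \<open>auto intro: continuous_on_subset[OF assms(1)] finite_subset[OF _ assms(2)]\<close>)
    then show False using assms(3) that by force
  qed
  consider "x < y" | "y < x" using xy by fastforce
  then show False
    by cases (use *[of x y] *[of y x] xy in \<open>auto simp: mult_neg_pos mult_pos_neg\<close>)
qed

text \<open>A critical point of the quotient \<open>f / g\<close> is a multiple zero of a member of the pencil. If \<open>g\<close> had no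
zero between \<open>x\<close> and \<open>y\<close>, Rolle's theorem would yield such a point.\<close>

lemma zero_between_zeros_of_simple_pencil:
  fixes f g f' g' :: "real \<Rightarrow> real"
  assumes der: "\<And>x. x \<in> {a<..<b} \<Longrightarrow> (f has_real_derivative f' x) (at x)"
      "\<And>x. x \<in> {a<..<b} \<Longrightarrow> (g has_real_derivative g' x) (at x)"
    and simple: "\<And>A B x. A \<noteq> 0 \<or> B \<noteq> 0 \<Longrightarrow> x \<in> {a<..<b} \<Longrightarrow> A * f x + B * g x = 0 \<Longrightarrow>
      A * f' x + B * g' x \<noteq> 0"
    and xy: "a < x" "x < y" "y < b" "f x = 0" "f y = 0"
  shows "\<exists>z. x < z \<and> z < y \<and> g z = 0"
proof (rule ccontr)
  assume no: "\<not> ?thesis"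
  have nocommon: "g t \<noteq> 0" if t: "t \<in> {a<..<b}" "f t = 0" for t
  proof
    assume "g t = 0"
    \<comment> \<open>at a common zero some member of the pencil has a vanishing derivative\<close>
    then show False
      using simple[of 1 0 t] simple[of "g' t" "- f' t" t] t by auto
  qed
  have gnz: "g t \<noteq> 0" if "t \<in> {x..y}" for t
    using that no nocommon[of x] nocommon[of y] xy by (cases "t = x \<or> t = y") auto
  define r where "r = (\<lambda>t. f t / g t)"
  have rder: "(r has_real_derivative (f' t * g t - f t * g' t) / (g t * g t)) (at t)" if "t \<in> {x..y}" for t
    unfolding r_def using that xy gnz by (intro DERIV_divide der) auto
  have "\<exists>t>x. t < y \<and> (r has_real_derivative 0) (at t)"
  proof (rule Rolle)
    show "continuous_on {x..y} r" using rder
      by (meson DERIV_isCont continuous_at_imp_continuous_on)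
    show "r differentiable at t" if "x < t" "t < y" for t
      using rder[of t] that by (auto simp: real_differentiable_def)
  qed (use xy in \<open>auto simp: r_def\<close>)
  then obtain t where t: "x < t" "t < y" "(r has_real_derivative 0) (at t)" by blast
  then have "(f' t * g t - f t * g' t) / (g t * g t) = 0"
    using rder[of t] DERIV_unique by fastforce
  then have "g t * f' t + (- f t) * g' t = 0" using gnz[of t] t by (auto simp: algebra_simps)
  then show False using simple[of "g t" "- f t" t] gnz[of t] t xy by auto
qed

text \<open>Consecutive zeros and uniqueness come for free: two zeros of one polynomial inside a gap of the
other would enclose a zero of the other.\<close>

lemma zeros_interlaceI:
  assumes "\<And>x y. poly P x = 0 \<Longrightarrow> poly P y = 0 \<Longrightarrow> x < y \<Longrightarrow> \<exists>z. x < z \<and> z < y \<and> poly R z = 0"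
    and "\<And>x y. poly R x = 0 \<Longrightarrow> poly R y = 0 \<Longrightarrow> x < y \<Longrightarrow> \<exists>z. x < z \<and> z < y \<and> poly P z = 0"
  shows "zeros_interlace P R"
proof -
  have *: "\<exists>!z. x < z \<and> z < y \<and> poly R z = 0"
    if between: "\<And>x y. poly P x = 0 \<Longrightarrow> poly P y = 0 \<Longrightarrow> x < y \<Longrightarrow> \<exists>z. x < z \<and> z < y \<and> poly R z = 0"
      "\<And>x y. poly R x = 0 \<Longrightarrow> poly R y = 0 \<Longrightarrow> x < y \<Longrightarrow> \<exists>z. x < z \<and> z < y \<and> poly P z = 0"
      and cons: "consecutive_zeros P x y" for P R x y
  proof -
    have xy: "x < y" "poly P x = 0" "poly P y = 0" "\<And>z. x < z \<Longrightarrow> z < y \<Longrightarrow> poly P z \<noteq> 0"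
      using cons by (auto simp: consecutive_zeros_def)
    obtain z where z: "x < z" "z < y" "poly R z = 0" using between(1)[OF xy(2,3,1)] by blast
    have no: False if uv: "x < u" "u < v" "v < y" "poly R u = 0" "poly R v = 0" for u v
    proof -
      obtain w where "u < w" "w < v" "poly P w = 0" using between(2)[OF uv(4,5,2)] by blast
      then show False using xy(4)[of w] uv by simp
    qed
    show ?thesis
    proof (rule ex1I[of _ z])
      fix w assume w: "x < w \<and> w < y \<and> poly R w = 0"
      show "w = z" using no[of w z] no[of z w] w z by (cases w z rule: linorder_cases) auto
    qed (use z in blast)
  qed
  show ?thesis
    unfolding zeros_interlace_def
    by (intro conjI allI impI) (rule *[OF assms] *[OF assms(2,1)]; assumption)+
qed

section \<open>Cauchy transforms of measures on an interval\<close>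

lemma borel_measurable_poly [measurable (raw)]:
  fixes p :: "'a::real_normed_field poly"
  shows "f \<in> borel_measurable M \<Longrightarrow> (\<lambda>x. poly p (f x)) \<in> borel_measurable M"
  by (rule measurable_compose[where N = borel]) (auto intro!: borel_measurable_continuous_onI continuous_intros)

text \<open>The last axiom expresses that the support is infinite. It is used in the form that a function
with finitely many zeros cannot vanish almost everywhere.\<close>

locale interval_measure = finite_measure M for M :: "real measure" +
  fixes a b :: real
  assumes sets_M [measurable_cong]: "sets M = sets borel"
    and a_less_b: "a < b"
    and AE_in_interval: "AE x in M. x \<in> {a..b}"
    and not_AE_in_finite: "finite F \<Longrightarrow> \<not> (AE x in M. x \<in> F)"
begin

lemma integrable_if_continuous:
  assumes [measurable]: "f \<in> borel_measurable borel" and "continuous_on {a..b} f"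
  shows "integrable M (f :: real \<Rightarrow> real)"
proof -
  have "compact (f ` {a..b})" using assms(2) by (intro compact_continuous_image) auto
  then obtain B where B: "\<And>x. x \<in> {a..b} \<Longrightarrow> \<bar>f x\<bar> \<le> B"
    by (metis bounded_iff compact_imp_bounded imageI real_norm_def)
  have "AE x in M. norm (f x) \<le> B" using AE_in_interval by eventually_elim (use B in auto)
  then show ?thesis by (intro integrable_const_bound) auto
qed

text \<open>If \<open>g\<close> had fewer than \<open>m\<close> sign changes, let \<open>q\<close> be the monic polynomial with simple zeros exactly there.
Then \<open>g q / P\<close> has constant sign and integral zero, so it vanishes almost everywhere, and the
measure would live on a finite set.\<close>

lemma orthogonal_imp_sign_changes:
  assumes g [measurable]: "g \<in> borel_measurable borel" and gc: "continuous_on {a..b} g"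
    and fin: "finite {x \<in> {a<..<b}. g x = 0}"
    and P: "\<And>x. x \<in> {a..b} \<Longrightarrow> poly P x \<noteq> 0"
    and orth: "\<And>q. degree q < m \<Longrightarrow> (\<integral>x. g x * poly q x / poly P x \<partial>M) = 0"
  shows "m \<le> card {c \<in> {a<..<b}. sign_change g c}"
proof (rule ccontr)
  define S where "S = {c \<in> {a<..<b}. sign_change g c}"
  assume "\<not> ?thesis"
  then have less: "card S < m" by (simp add: S_def)
  have cont: "isCont g c" if "c \<in> {a<..<b}" for c
    using gc that by (simp add: continuous_on_interior)
  have "S \<subseteq> {x \<in> {a<..<b}. g x = 0}" using sign_change_imp_zero cont by (auto simp: S_def)
  then have finS: "finite S" using fin finite_subset by blast
  \<comment> \<open>exactly the sign changes of \<open>g\<close>, so that \<open>g q\<close> has none\<close>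
  define q where "q = (\<Prod>c\<in>S. [:- c, 1:])"
  have deg: "degree q = card S"
    unfolding q_def using finS by (subst degree_prod_eq_sum_degree) auto
  have q0: "poly q x = 0 \<longleftrightarrow> x \<in> S" for x
    using finS by (auto simp: q_def poly_prod)
  define u where "u = (\<lambda>x. g x * poly q x / poly P x)"
  have [measurable]: "u \<in> borel_measurable borel" unfolding u_def by measurable
  have uc: "continuous_on {a..b} u" unfolding u_def using P by (intro continuous_intros gc) auto
  have uint: "integrable M u" by (rule integrable_if_continuous) (use uc in auto)
  have u0: "{x \<in> {a<..<b}. u x = 0} \<subseteq> {x \<in> {a<..<b}. g x = 0} \<union> S"
    using P q0 by (auto simp: u_def)
  have finu: "finite {x \<in> {a<..<b}. u x = 0}" using finite_subset[OF u0] fin finS by blast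
  have nosc: "\<not> sign_change u c" if c: "c \<in> {a<..<b}" for c
  proof (cases "c \<in> S")
    case False
    have "isCont (\<lambda>x. poly q x / poly P x) c" using P c by (intro continuous_intros) auto
    then have "sign_change (\<lambda>x. g x * (poly q x / poly P x)) c \<longleftrightarrow> sign_change g c"
      using P[of c] c False q0 by (intro sign_change_mult_iff) auto
    then show ?thesis using False c by (simp add: u_def S_def)
  next
    case True
    define r where "r = (\<Prod>c\<in>S-{c}. [:- c, 1:])"
    have qr: "q = [:-c, 1:] * r" unfolding q_def r_def using True finS by (subst prod.remove[of _ c]) auto
    have rc: "poly r c \<noteq> 0" using finS by (auto simp: r_def poly_prod)
    have ueq: "u = (\<lambda>x. (g x * (x - c)) * (poly r x / poly P x))"
      by (auto simp: u_def qr fun_eq_iff field_simps)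
    have "isCont (\<lambda>x. poly r x / poly P x) c" using P c by (intro continuous_intros) auto
    then have "sign_change u c \<longleftrightarrow> sign_change (\<lambda>x. g x * (x - c)) c"
      unfolding ueq using P[of c] c rc by (intro sign_change_mult_iff) auto
    then show ?thesis using sign_change_mult_linear True by (auto simp: S_def)
  qed
  have int0: "(\<integral>x. u x \<partial>M) = 0" unfolding u_def by (rule orth) (use deg less in auto)
  have cl: "closure {a<..<b} = {a..b}" using a_less_b by (rule closure_greaterThanLessThan)
  have "AE x in M. u x = 0"
    using constant_sign_if_no_sign_change[OF continuous_on_subset[OF uc] finu nosc]
  proof
    show "{a<..<b} \<subseteq> {a..b}" by auto
  next
    assume pos: "\<forall>x\<in>{a<..<b}. 0 \<le> u x"
    have "0 \<le> u x" if "x \<in> {a..b}" for x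
      by (rule continuous_ge_on_closure[of "{a<..<b}"]) (use that cl pos uc in auto)
    then have "AE x in M. 0 \<le> u x" using AE_in_interval by auto
    then show ?thesis using integral_nonneg_eq_0_iff_AE[OF uint] int0 by simp
  next
    assume neg: "\<forall>x\<in>{a<..<b}. u x \<le> 0"
    have "u x \<le> 0" if "x \<in> {a..b}" for x
      by (rule continuous_le_on_closure[of "{a<..<b}"]) (use that cl neg uc in auto)
    then have "AE x in M. 0 \<le> - u x" using AE_in_interval by auto
    then show ?thesis
      using integral_nonneg_eq_0_iff_AE[where f = "\<lambda>x. - u x" and M = M] int0 uint by simp
  qed
  then have "AE x in M. x \<in> {x \<in> {a<..<b}. u x = 0} \<union> {a, b}"
    using AE_in_interval by eventually_elim auto
  then show False using not_AE_in_finite[of "{x \<in> {a<..<b}. u x = 0} \<union> {a, b}"] finu by simp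
qed

lemma integral_cong_on_interval:
  fixes f g :: "real \<Rightarrow> real"
  assumes [measurable]: "f \<in> borel_measurable borel" "g \<in> borel_measurable borel"
    and "\<And>x. x \<in> {a..b} \<Longrightarrow> f x = g x"
  shows "(\<integral>x. f x \<partial>M) = (\<integral>x. g x \<partial>M)"
proof (rule integral_cong_AE)
  show "AE x in M. f x = g x" using AE_in_interval by eventually_elim (use assms in auto)
qed measurable

text \<open>By partial fractions the rational function is a combination of powers below \<open>m\<close> and of the
principal parts at the points of \<open>X\<close>, whose multiplicities are the orders of the poles. The
induction adds one pole at a time.\<close>

lemma orthogonal_to_rational:
  assumes g [measurable]: "g \<in> borel_measurable borel" and gc: "continuous_on {a..b} g"
    and moments: "\<And>s. s < m \<Longrightarrow> (\<integral>t. g t * t ^ s \<partial>M) = 0"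
    and "set_mset X \<inter> {a..b} = {}"
    and "\<And>x j. x \<in># X \<Longrightarrow> 1 \<le> j \<Longrightarrow> j \<le> count X x \<Longrightarrow> (\<integral>t. g t / (x - t) ^ j \<partial>M) = 0"
    and "degree q < m + size X"
  shows "(\<integral>t. g t * poly q t / poly (\<Prod>x\<in>#X. [:- x, 1:]) t \<partial>M) = 0"
  using assms(4-)
proof (induction X arbitrary: q)
  case empty
  have "(\<integral>t. g t * poly q t \<partial>M) = (\<integral>t. (\<Sum>i\<le>degree q. coeff q i * (g t * t ^ i)) \<partial>M)"
    by (simp add: poly_altdef sum_distrib_left ac_simps)
  also have "\<dots> = (\<Sum>i\<le>degree q. \<integral>t. coeff q i * (g t * t ^ i) \<partial>M)"
    by (intro Bochner_Integration.integral_sum integrable_mult_right integrable_if_continuous)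
      (auto intro!: continuous_intros gc)
  also have "\<dots> = 0" using empty moments by (intro sum.neutral) auto
  finally show ?case by simp
next
  case (add x0 X)
  define P where "P = (\<Prod>x\<in>#X. [:- x, 1:])"
  define R where "R = (\<Prod>x\<in>#filter_mset (\<lambda>x. x \<noteq> x0) X. [:- x, 1:])"
  have Pnz: "poly P t \<noteq> 0" if "t \<in> {a..b}" for t
    using that add.prems(1) by (auto simp: P_def poly_prod_mset prod_mset_zero_iff image_iff)
  have R0: "poly R x0 \<noteq> 0"
    by (auto simp: R_def poly_prod_mset prod_mset_zero_iff image_iff)
  have degR: "degree R \<le> size X"
  proof -
    have "degree (\<Prod>x\<in>#Y. [:- x, 1:]) \<le> size Y" for Y :: "real multiset"
    proof (induction Y)
      case (add y Y)
      have "degree ([:- y, 1:] * (\<Prod>x\<in>#Y. [:- x, 1:])) \<le> Suc (size Y)"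
        using degree_mult_le[of "[:- y, 1:]" "\<Prod>x\<in>#Y. [:- x, 1:]"] add.IH by simp
      then show ?case by (simp only: image_mset_add_mset prod_mset.add_mset size_add_mset)
    qed simp
    from this[of "filter_mset (\<lambda>x. x \<noteq> x0) X"] show ?thesis
      unfolding R_def using size_filter_mset_lesseq[of "\<lambda>x. x \<noteq> x0" X] by linarith
  qed
  have PR: "P = [:- x0, 1:] ^ count X x0 * R"
  proof -
    have X: "X = replicate_mset (count X x0) x0 + filter_mset (\<lambda>x. x \<noteq> x0) X"
      by (rule multiset_eqI) auto
    show ?thesis unfolding P_def R_def by (subst X) simp
  qed
  \<comment> \<open>Only the numerator \<open>R\<close> sees the pole at \<open>x0\<close> of highest order; the rest of \<open>q\<close> cancels
    one factor of the denominator.\<close>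
  define c where "c = poly q x0 / poly R x0"
  have "poly (q - smult c R) x0 = 0" using R0 by (simp add: c_def)
  then obtain q1 where q1: "q - smult c R = [:- x0, 1:] * q1"
    unfolding poly_eq_0_iff_dvd dvd_def by blast
  have q: "q = smult c R + [:- x0, 1:] * q1" using q1 by (simp add: algebra_simps)
  have degq: "degree (q - smult c R) \<le> m + size X"
    using add.prems(3) degR degree_smult_le[of c R] by (intro degree_diff_le) auto
  have rest: "(\<integral>t. g t * poly q1 t / poly P t \<partial>M) = 0"
  proof (cases "q1 = 0")
    case False
    then have "degree (q - smult c R) = Suc (degree q1)" unfolding q1 by (subst degree_mult_eq) auto
    then have "degree q1 < m + size X" using degq by simp
    then show ?thesis unfolding P_def
      by (intro add.IH) (use add.prems in auto)
  qed simp
  have pole: "(\<integral>t. g t / (x0 - t) ^ Suc (count X x0) \<partial>M) = 0"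
    by (intro add.prems(2)) auto
  have x0: "t - x0 \<noteq> 0" "x0 - t \<noteq> 0" if "t \<in> {a..b}" for t using that add.prems(1) by auto
  define k where "k = Suc (count X x0)"
  have pw: "(t - x0) ^ k = (-1) ^ k * (x0 - t) ^ k" for t
    by (metis minus_diff_eq power_minus)
  have int: "integrable M (\<lambda>t. g t / (x0 - t) ^ k)" "integrable M (\<lambda>t. g t * poly q1 t / poly P t)"
    using x0 Pnz by (auto intro!: integrable_if_continuous continuous_intros gc)
  have "(\<integral>t. g t * poly q t / poly (\<Prod>x\<in>#add_mset x0 X. [:- x, 1:]) t \<partial>M) =
      (\<integral>t. (c * (-1) ^ k) * (g t / (x0 - t) ^ k) + g t * poly q1 t / poly P t \<partial>M)"
  proof (rule integral_cong_on_interval)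
    fix t assume t: "t \<in> {a..b}"
    have P': "poly (\<Prod>x\<in>#add_mset x0 X. [:- x, 1:]) t = (t - x0) * poly P t" by (simp add: P_def algebra_simps)
    have Pk: "(t - x0) * poly P t = (t - x0) ^ k * poly R t" by (simp add: PR k_def poly_power)
    have Rt: "poly R t \<noteq> 0" using Pk Pnz[OF t] x0[OF t] by auto
    have "g t * poly q t / poly (\<Prod>x\<in>#add_mset x0 X. [:- x, 1:]) t =
        c * (g t * poly R t / ((t - x0) * poly P t)) + g t * ((t - x0) * poly q1 t) / ((t - x0) * poly P t)"
      unfolding P' q by (simp add: algebra_simps add_divide_distrib diff_divide_distrib)
    also have "g t * ((t - x0) * poly q1 t) / ((t - x0) * poly P t) = g t * poly q1 t / poly P t"
      using x0[OF t] by (metis mult.left_commute mult_divide_mult_cancel_left)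
    also have "g t * poly R t / ((t - x0) * poly P t) = g t / (t - x0) ^ k"
      unfolding Pk using Rt by simp
    also have "g t / (t - x0) ^ k = (-1) ^ k * (g t / (x0 - t) ^ k)"
      unfolding pw by (cases "even k") auto
    finally show "g t * poly q t / poly (\<Prod>x\<in>#add_mset x0 X. [:- x, 1:]) t =
        (c * (-1) ^ k) * (g t / (x0 - t) ^ k) + g t * poly q1 t / poly P t" by (simp add: ac_simps)
  qed measurable
  also have "\<dots> = (c * (-1) ^ k) * (\<integral>t. g t / (x0 - t) ^ k \<partial>M) + (\<integral>t. g t * poly q1 t / poly P t \<partial>M)"
    using int by (simp del: times_divide_eq_right)
  finally show ?case using rest pole by (simp add: k_def)
qed

text \<open>The Taylor formula of order two with an exact remainder, which is again a Cauchy transform. It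
gives the derivative as well as the local behaviour at a double zero.\<close>

lemma cauchy_transform_expansion:
  assumes g [measurable]: "g \<in> borel_measurable borel" and gc: "continuous_on {a..b} g"
    and x: "x \<notin> {a..b}" and y: "y \<notin> {a..b}"
  shows "(\<integral>t. g t / (y - t) \<partial>M) = (\<integral>t. g t / (x - t) \<partial>M)
     - (y - x) * (\<integral>t. g t / (x - t)\<^sup>2 \<partial>M) + (y - x)\<^sup>2 * (\<integral>t. g t / ((x - t)\<^sup>2 * (y - t)) \<partial>M)"
proof -
  have int: "integrable M (\<lambda>t. g t / (x - t))" "integrable M (\<lambda>t. g t / (x - t)\<^sup>2)"
      "integrable M (\<lambda>t. g t / ((x - t)\<^sup>2 * (y - t)))"
    using x y by (auto intro!: integrable_if_continuous continuous_intros gc)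
  have "(\<integral>t. g t / (y - t) \<partial>M) =
     (\<integral>t. g t / (x - t) - (y - x) * (g t / (x - t)\<^sup>2) + (y - x)\<^sup>2 * (g t / ((x - t)\<^sup>2 * (y - t))) \<partial>M)"
  proof (rule integral_cong_on_interval)
    fix t assume t: "t \<in> {a..b}"
    define u v where "u = x - t" and "v = y - t"
    have nz: "u \<noteq> 0" "v \<noteq> 0" and yx: "y - x = v - u" using x y t by (auto simp: u_def v_def)
    show "g t / (y - t) = g t / (x - t) - (y - x) * (g t / (x - t)\<^sup>2) + (y - x)\<^sup>2 * (g t / ((x - t)\<^sup>2 * (y - t)))"
      unfolding yx u_def[symmetric] v_def[symmetric] using nz
      by (simp add: field_simps power2_eq_square)
  qed measurable
  then show ?thesis using int by (simp del: times_divide_eq_right)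
qed

lemma cauchy_transform_locally_bounded:
  assumes g [measurable]: "g \<in> borel_measurable borel" and gc: "continuous_on {a..b} g"
    and x: "x \<notin> {a..b}"
  obtains B \<delta> where "\<delta> > 0" "B \<ge> 0"
    "\<And>y. \<bar>y - x\<bar> < \<delta> \<Longrightarrow> y \<notin> {a..b}"
    "\<And>y. \<bar>y - x\<bar> < \<delta> \<Longrightarrow> \<bar>\<integral>t. g t / (y - t) \<partial>M\<bar> \<le> B"
proof -
  obtain e where e: "e > 0" "\<And>t. t \<in> {a..b} \<Longrightarrow> e \<le> \<bar>x - t\<bar>"
    using separate_point_closed[of "{a..b}" x] x by (auto simp: dist_real_def)
  have gap: "\<bar>y - t\<bar> \<ge> e/2" if "\<bar>y - x\<bar> < e/2" "t \<in> {a..b}" for y t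
    using e(2)[OF that(2)] that(1) by linarith
  have intg: "integrable M (\<lambda>t. \<bar>g t\<bar> * (2/e))"
    by (intro integrable_mult_left integrable_abs integrable_if_continuous gc g)
  have "\<bar>\<integral>t. g t / (y - t) \<partial>M\<bar> \<le> (\<integral>t. \<bar>g t\<bar> * (2/e) \<partial>M)" if y: "\<bar>y - x\<bar> < e/2" for y
  proof -
    have nz: "y - t \<noteq> 0" if "t \<in> {a..b}" for t using gap[OF y that] e by auto
    have "\<bar>\<integral>t. g t / (y - t) \<partial>M\<bar> \<le> (\<integral>t. \<bar>g t / (y - t)\<bar> \<partial>M)" by (rule integral_abs_bound)
    also have "\<dots> \<le> (\<integral>t. \<bar>g t\<bar> * (2/e) \<partial>M)"
    proof (rule integral_mono_AE[OF _ intg])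
      show "integrable M (\<lambda>t. \<bar>g t / (y - t)\<bar>)"
        using nz by (intro integrable_abs integrable_if_continuous) (auto intro!: continuous_intros gc)
      show "AE t in M. \<bar>g t / (y - t)\<bar> \<le> \<bar>g t\<bar> * (2/e)"
        using AE_in_interval
      proof eventually_elim
        case (elim t)
        have "1 / \<bar>y - t\<bar> \<le> 1 / (e / 2)" using gap[OF y elim] e(1) by (intro frac_le) auto
        then have "\<bar>g t\<bar> * (1 / \<bar>y - t\<bar>) \<le> \<bar>g t\<bar> * (2 / e)" by (intro mult_left_mono) auto
        then show ?case by (simp add: abs_divide)
      qed
    qed
    finally show ?thesis .
  qed
  moreover have "y \<notin> {a..b}" if "\<bar>y - x\<bar> < e/2" for y using gap[OF that, of y] e by auto
  moreover have "0 \<le> (\<integral>t. \<bar>g t\<bar> * (2/e) \<partial>M)" using e by (intro integral_nonneg_AE) auto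
  moreover have "e/2 > 0" using e(1) by simp
  ultimately show thesis by (intro that[of "e/2" "\<integral>t. \<bar>g t\<bar> * (2/e) \<partial>M"]) blast+
qed

lemma has_derivative_cauchy_transform:
  assumes g [measurable]: "g \<in> borel_measurable borel" and gc: "continuous_on {a..b} g"
    and x: "x \<notin> {a..b}"
  shows "((\<lambda>y. \<integral>t. g t / (y - t) \<partial>M) has_real_derivative - (\<integral>t. g t / (x - t)\<^sup>2 \<partial>M)) (at x)"
proof -
  define h where "h = (\<lambda>t. g t / (x - t)\<^sup>2)"
  have [measurable]: "h \<in> borel_measurable borel" unfolding h_def by measurable
  have hc: "continuous_on {a..b} h" unfolding h_def using x by (auto intro!: continuous_intros gc)
  obtain B \<delta> where B: "\<delta> > 0" "B \<ge> 0" "\<And>y. \<bar>y - x\<bar> < \<delta> \<Longrightarrow> y \<notin> {a..b}"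
      "\<And>y. \<bar>y - x\<bar> < \<delta> \<Longrightarrow> \<bar>\<integral>t. h t / (y - t) \<partial>M\<bar> \<le> B"
    by (rule cauchy_transform_locally_bounded[OF _ hc x]) auto
  let ?F = "\<lambda>y. \<integral>t. g t / (y - t) \<partial>M"
  let ?D = "- (\<integral>t. g t / (x - t)\<^sup>2 \<partial>M)"
  have eq: "(?F y - ?F x) / (y - x) - ?D = (y - x) * (\<integral>t. h t / (y - t) \<partial>M)"
    if "\<bar>y - x\<bar> < \<delta>" "y \<noteq> x" for y
    using cauchy_transform_expansion[OF g gc x B(3)[OF that(1)]] that(2)
    by (simp add: h_def field_simps power2_eq_square)
  have "((\<lambda>y. (?F y - ?F x) / (y - x) - ?D) \<longlongrightarrow> 0) (at x)"
  proof (rule Lim_null_comparison)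
    have "eventually (\<lambda>y. \<bar>y - x\<bar> < \<delta> \<and> y \<noteq> x) (at x)"
      unfolding eventually_at by (rule exI[of _ \<delta>]) (use B in \<open>auto simp: dist_real_def\<close>)
    then show "eventually (\<lambda>y. norm ((?F y - ?F x) / (y - x) - ?D) \<le> \<bar>y - x\<bar> * B) (at x)"
    proof eventually_elim
      case (elim y)
      then show ?case unfolding eq[of y, OF conjunct1[OF elim] conjunct2[OF elim]]
        by (auto simp: abs_mult intro!: mult_left_mono B)
    qed
    have "((\<lambda>y. \<bar>y - x\<bar> * B) \<longlongrightarrow> \<bar>x - x\<bar> * B) (at x)" by (intro tendsto_intros)
    then show "((\<lambda>y. \<bar>y - x\<bar> * B) \<longlongrightarrow> 0) (at x)" by simp
  qed
  then show ?thesis unfolding has_field_derivative_iff by (rule LIM_zero_cancel)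
qed

text \<open>At a double zero the transform is \<open>(y - x)\<^sup>2\<close> times another Cauchy transform, and a nonzero
value of the latter at \<open>x\<close> would exclude a sign change.\<close>

lemma triple_zero_if_double_zero_sign_change:
  assumes g [measurable]: "g \<in> borel_measurable borel" and gc: "continuous_on {a..b} g"
    and x: "x \<notin> {a..b}"
    and zero: "(\<integral>t. g t / (x - t) \<partial>M) = 0" and zero2: "(\<integral>t. g t / (x - t)\<^sup>2 \<partial>M) = 0"
    and sc: "sign_change (\<lambda>y. \<integral>t. g t / (y - t) \<partial>M) x"
  shows "(\<integral>t. g t / (x - t) ^ 3 \<partial>M) = 0"
proof (rule ccontr)
  assume nz: "(\<integral>t. g t / (x - t) ^ 3 \<partial>M) \<noteq> 0"
  define h where "h = (\<lambda>t. g t / (x - t)\<^sup>2)"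
  have [measurable]: "h \<in> borel_measurable borel" unfolding h_def by measurable
  have hc: "continuous_on {a..b} h" unfolding h_def using x by (auto intro!: continuous_intros gc)
  let ?F = "\<lambda>y. \<integral>t. g t / (y - t) \<partial>M"
  let ?H = "\<lambda>y. \<integral>t. h t / (y - t) \<partial>M"
  have Hc: "isCont ?H x" using has_derivative_cauchy_transform[OF _ hc x] by (auto intro: DERIV_isCont)
  have Hnz: "?H x \<noteq> 0" using nz by (simp add: h_def power3_eq_cube power2_eq_square)
  obtain d1 where d1: "d1 > 0" "\<And>y. \<bar>y - x\<bar> < d1 \<Longrightarrow> ?H y * ?H x > 0"
    by (rule isCont_same_sign_nhd[OF Hc Hnz]) blast
  obtain d2 where d2: "d2 > 0" "\<And>y. \<bar>y - x\<bar> < d2 \<Longrightarrow> y \<notin> {a..b}"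
    by (rule cauchy_transform_locally_bounded[OF g gc x]) blast
  obtain d3 where d3: "d3 > 0" "\<And>u v. x - d3 < u \<Longrightarrow> u < x \<Longrightarrow> x < v \<Longrightarrow> v < x + d3 \<Longrightarrow> ?F u * ?F v < 0"
    using sc unfolding sign_change_def by blast
  define d where "d = min d1 (min d2 d3) / 2"
  have d: "d > 0" "d < d1" "d < d2" "d < d3" using d1 d2 d3 by (auto simp: d_def)
  have F: "?F y = (y - x)\<^sup>2 * ?H y" if "\<bar>y - x\<bar> < d2" for y
    using cauchy_transform_expansion[OF g gc x d2(2)[OF that]] zero zero2 by (simp add: h_def)
  have "?F (x - d) * ?F (x + d) < 0" using d by (intro d3) auto
  moreover have "?F (x - d) * ?F (x + d) = d ^ 4 * (?H (x - d) * ?H (x + d))"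
  proof -
    have "?F (x - d) = d\<^sup>2 * ?H (x - d)" "?F (x + d) = d\<^sup>2 * ?H (x + d)"
      using F[of "x - d"] F[of "x + d"] d by simp_all
    moreover have "d ^ 4 = d\<^sup>2 * d\<^sup>2" by (simp flip: power_add)
    ultimately show ?thesis by (simp only: ac_simps)
  qed
  moreover have "?H (x - d) * ?H (x + d) > 0"
    using d1(2)[of "x - d"] d1(2)[of "x + d"] d
    by (smt (verit) zero_less_mult_iff)
  ultimately show False using d by (smt (verit) zero_less_mult_iff zero_less_power)
qed

lemma continuous_on_cauchy_transform:
  assumes "g \<in> borel_measurable borel" "continuous_on {a..b} g" "S \<inter> {a..b} = {}"
  shows "continuous_on S (\<lambda>y. \<integral>t. g t / (y - t) \<partial>M)"
proof (rule continuous_at_imp_continuous_on, rule ballI)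
  fix x assume "x \<in> S"
  then have "x \<notin> {a..b}" using assms(3) by blast
  then show "isCont (\<lambda>y. \<integral>t. g t / (y - t) \<partial>M) x"
    using has_derivative_cauchy_transform[OF assms(1,2)] by (auto intro: DERIV_isCont)
qed

lemma borel_measurable_cauchy_transform:
  assumes [measurable]: "g \<in> borel_measurable borel"
  shows "(\<lambda>y. \<integral>t. g t / (y - t) \<partial>M) \<in> borel_measurable borel"
  by (rule borel_measurable_lebesgue_integral) measurable

text \<open>The difference of \<open>t\<^sup>s\<close> and \<open>x\<^sup>s\<close> is divisible by \<open>x - t\<close>, and the quotient is a polynomial in \<open>t\<close> of
degree less than \<open>s\<close>, to which \<open>g\<close> is orthogonal.\<close>

lemma cauchy_transform_power:
  assumes g [measurable]: "g \<in> borel_measurable borel" and gc: "continuous_on {a..b} g"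
    and x: "x \<notin> {a..b}" and "\<And>i. i < s \<Longrightarrow> (\<integral>t. g t * t ^ i \<partial>M) = 0"
  shows "(\<integral>t. g t * t ^ s / (x - t) \<partial>M) = x ^ s * (\<integral>t. g t / (x - t) \<partial>M)"
  using assms(4)
proof (induction s)
  case (Suc s)
  have int: "integrable M (\<lambda>t. g t * t ^ s / (x - t))" "integrable M (\<lambda>t. g t * t ^ s)"
    using x by (auto intro!: integrable_if_continuous continuous_intros gc)
  have "(\<integral>t. g t * t ^ Suc s / (x - t) \<partial>M) = (\<integral>t. x * (g t * t ^ s / (x - t)) - g t * t ^ s \<partial>M)"
    by (rule integral_cong_on_interval) (use x in \<open>auto simp: divide_simps algebra_simps\<close>)
  also have "\<dots> = x * (\<integral>t. g t * t ^ s / (x - t) \<partial>M) - (\<integral>t. g t * t ^ s \<partial>M)"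
    using int by (simp del: times_divide_eq_right)
  finally show ?case using Suc by simp
qed simp

end

text \<open>Fubini's theorem; the kernel is bounded because the intervals are disjoint, and the sign appears
because it is antisymmetric.\<close>

lemma swap_cauchy_transform:
  assumes "interval_measure M a b" "interval_measure N c d" and disj: "{a..b} \<inter> {c..d} = {}"
    and f [measurable]: "f \<in> borel_measurable borel" and fc: "continuous_on {a..b} f"
    and h [measurable]: "h \<in> borel_measurable borel" and hc: "continuous_on {c..d} h"
  shows "(\<integral>t. f t * (\<integral>u. h u / (t - u) \<partial>N) \<partial>M) = - (\<integral>u. h u * (\<integral>t. f t / (u - t) \<partial>M) \<partial>N)"
proof -
  interpret M: interval_measure M a b by fact
  interpret N: interval_measure N c d by fact
  interpret pair_sigma_finite M N ..
  interpret MN: finite_measure "M \<Otimes>\<^sub>M N"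
    by (rule finite_measure_pair_measure) (rule N.finite_measure_axioms M.finite_measure_axioms)+
  note [measurable_cong] = M.sets_M N.sets_M
  define k where "k = (\<lambda>t u. indicator {a..b} t * indicator {c..d} u * (f t * h u / (t - u)))"
  have "compact ((\<lambda>(t, u). f t * h u / (t - u)) ` ({a..b} \<times> {c..d}))"
    unfolding case_prod_unfold using disj
    by (intro compact_continuous_image continuous_intros compact_Times
          continuous_on_compose2[OF fc] continuous_on_compose2[OF hc]) auto
  from compact_imp_bounded[OF this]
  obtain B where B: "\<And>t u. t \<in> {a..b} \<Longrightarrow> u \<in> {c..d} \<Longrightarrow> \<bar>f t * h u / (t - u)\<bar> \<le> B"
    unfolding bounded_iff by fastforce
  have "integrable (M \<Otimes>\<^sub>M N) (case_prod k)"
  proof (rule MN.integrable_const_bound)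
    have "\<bar>k t u\<bar> \<le> max 0 B" for t u
      using B[of t u] by (auto simp: k_def indicator_def)
    then show "AE x in M \<Otimes>\<^sub>M N. norm (case_prod k x) \<le> max 0 B" by auto
    show "case_prod k \<in> borel_measurable (M \<Otimes>\<^sub>M N)" unfolding k_def by measurable
  qed
  then have F: "(\<integral>u. (\<integral>t. k t u \<partial>M) \<partial>N) = (\<integral>t. (\<integral>u. k t u \<partial>N) \<partial>M)" by (rule Fubini_integral)
  have "(\<integral>u. k t u \<partial>N) = f t * (\<integral>u. h u / (t - u) \<partial>N)" if "t \<in> {a..b}" for t
  proof -
    have "(\<integral>u. k t u \<partial>N) = (\<integral>u. f t * (h u / (t - u)) \<partial>N)"
      unfolding k_def by (rule N.integral_cong_on_interval) (use that in auto)
    then show ?thesis by (simp del: times_divide_eq_right)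
  qed
  then have 1: "(\<integral>t. (\<integral>u. k t u \<partial>N) \<partial>M) = (\<integral>t. f t * (\<integral>u. h u / (t - u) \<partial>N) \<partial>M)"
    by (intro integral_cong_AE) (use M.AE_in_interval in \<open>auto simp: k_def\<close>)
  have "(\<integral>t. k t u \<partial>M) = - (h u * (\<integral>t. f t / (u - t) \<partial>M))" if "u \<in> {c..d}" for u
  proof -
    have "(\<integral>t. k t u \<partial>M) = (\<integral>t. - h u * (f t / (u - t)) \<partial>M)"
      unfolding k_def
    proof (rule M.integral_cong_on_interval)
      fix t assume "t \<in> {a..b}"
      then show "indicator {a..b} t * indicator {c..d} u * (f t * h u / (t - u)) = - h u * (f t / (u - t))"
        using that disj by (auto simp: field_simps)
    qed measurable
    then show ?thesis by (simp del: times_divide_eq_right)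
  qed
  then have 2: "(\<integral>u. (\<integral>t. k t u \<partial>M) \<partial>N) = (\<integral>u. - (h u * (\<integral>t. f t / (u - t) \<partial>M)) \<partial>N)"
    by (intro integral_cong_AE) (use N.AE_in_interval in \<open>auto simp: k_def\<close>)
  show ?thesis using F 1 2 by simp
qed

section \<open>Polynomials and linear systems\<close>

lemma size_proots_le_degree:
  fixes q :: "'a::idom poly"
  assumes "q \<noteq> 0"
  shows "size (proots q) \<le> degree q"
  using assms
proof (induction "degree q" arbitrary: q rule: less_induct)
  case less
  show ?case
  proof (cases "\<exists>x. poly q x = 0")
    case True
    then obtain x r where q: "q = [:- x, 1:] * r" unfolding poly_eq_0_iff_dvd dvd_def by blast
    have "r \<noteq> 0" using less.prems q by auto
    have "degree q = Suc (degree r)" unfolding q using \<open>r \<noteq> 0\<close> by (subst degree_mult_eq) auto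
    moreover have "proots q = proots [:- x, 1:] + proots r"
      using \<open>r \<noteq> 0\<close> unfolding q by (intro proots_mult) auto
    moreover have "proots [:- x, 1:] = {#x#}"
    proof (rule multiset_eqI)
      fix y show "count (proots [:- x, 1:]) y = count {#x#} y"
        using order_power_n_n[of x 1] order_0I[of "[:- x, 1:]" y] by (cases "y = x") auto
    qed
    ultimately show ?thesis using less.hyps[of r] \<open>r \<noteq> 0\<close> by simp
  next
    case False
    then have "set_mset (proots q) = {}" using set_count_proots[OF less.prems] by simp
    then have "proots q = {#}" by simp
    then show ?thesis by simp
  qed
qed

text \<open>This supplies the orthogonal polynomials: there are fewer conditions than coefficients.\<close>

lemma homogeneous_system_nontrivial_solution:
  fixes A :: "nat \<Rightarrow> 'i \<Rightarrow> real"
  assumes "finite I" "m < card I"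
  shows "\<exists>c. (\<exists>i\<in>I. c i \<noteq> 0) \<and> (\<forall>j<m. (\<Sum>i\<in>I. A j i * c i) = 0)"
  using assms
proof (induction m arbitrary: I A)
  case 0
  then obtain i where "i \<in> I" by (metis all_not_in_conv card.empty less_irrefl)
  then show ?case by (intro exI[of _ "\<lambda>_. 1"]) auto
next
  case (Suc m)
  show ?case
  proof (cases "\<forall>i\<in>I. A m i = 0")
    case True
    obtain c where "\<exists>i\<in>I. c i \<noteq> 0" "\<forall>j<m. (\<Sum>i\<in>I. A j i * c i) = 0"
      using Suc.IH[of I A] Suc.prems by auto
    then show ?thesis using True by (intro exI[of _ c]) (auto simp: less_Suc_eq)
  next
    case False
    then obtain k where k: "k \<in> I" "A m k \<noteq> 0" by blast
    define J where "J = I - {k}"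
    have J: "finite J" "k \<notin> J" "I = insert k J" using Suc.prems k by (auto simp: J_def)
    have "m < card J" using Suc.prems(2) J by simp
    \<comment> \<open>eliminate the variable \<open>k\<close> by means of the equation \<open>m\<close>\<close>
    then obtain c where c: "\<exists>i\<in>J. c i \<noteq> 0"
        "\<And>j. j < m \<Longrightarrow> (\<Sum>i\<in>J. (A j i - A j k * A m i / A m k) * c i) = 0"
      using Suc.IH[of J "\<lambda>j i. A j i - A j k * A m i / A m k"] J by blast
    define s where "s = (\<Sum>i\<in>J. A m i * c i)"
    define c' where "c' = c(k := - s / A m k)"
    have sumI: "(\<Sum>i\<in>I. A j i * c' i) = (\<Sum>i\<in>J. A j i * c i) - A j k * s / A m k" for j
    proof -
      have "(\<Sum>i\<in>J. A j i * c' i) = (\<Sum>i\<in>J. A j i * c i)"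
        using J by (intro sum.cong) (auto simp: c'_def)
      then show ?thesis unfolding J(3) using J(1,2) by (simp add: c'_def)
    qed
    have "(\<Sum>i\<in>I. A j i * c' i) = 0" if "j < Suc m" for j
    proof (cases "j = m")
      case True
      then show ?thesis unfolding sumI using k by (simp add: s_def)
    next
      case False
      then have "0 = (\<Sum>i\<in>J. (A j i - A j k * A m i / A m k) * c i)" using that c(2) by simp
      also have "\<dots> = (\<Sum>i\<in>J. A j i * c i) - (\<Sum>i\<in>J. A j k / A m k * (A m i * c i))"
        unfolding sum_subtractf[symmetric] by (intro sum.cong) (auto simp: algebra_simps)
      also have "(\<Sum>i\<in>J. A j k / A m k * (A m i * c i)) = A j k * s / A m k"
        unfolding sum_distrib_left[symmetric] s_def by simp
      finally show ?thesis unfolding sumI by simp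
    qed
    moreover have "\<exists>i\<in>I. c' i \<noteq> 0" using c(1) J by (auto simp: c'_def)
    ultimately show ?thesis by blast
  qed
qed

lemma monic_independent:
  fixes q1 q2 :: "real poly"
  assumes "lead_coeff q1 = 1" "lead_coeff q2 = 1" "degree q1 = degree q2" "q1 \<noteq> q2" "A \<noteq> 0 \<or> B \<noteq> 0"
  shows "smult A q1 + smult B q2 \<noteq> 0"
proof
  assume eq: "smult A q1 + smult B q2 = 0"
  then have "coeff (smult A q1 + smult B q2) (degree q1) = 0" by simp
  then have "A + B = 0" using assms(1-3) by simp
  then have B: "B = - A" by simp
  then have "smult A (q1 - q2) = 0" using eq by (simp add: smult_diff_right)
  then show False using assms(4,5) B by simp
qed

lemma poly_map_poly_of_real:
  "poly (map_poly complex_of_real q) (of_real x) = of_real (poly q x)"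
  by (induction q) (auto simp: map_poly_pCons)

section \<open>The system on the real line: transfer of orthogonality\<close>

text \<open>Since \<open>0\<close> is not interior to any of the intervals, multiplication by the variable affects neither
the zeros nor the sign changes inside them.\<close>

locale real_nikishin =
  fixes p :: nat and a b :: "nat \<Rightarrow> real" and \<mu> :: "nat \<Rightarrow> real measure"
  assumes p_pos: "1 \<le> p"
    and interval_measure: "k < p \<Longrightarrow> interval_measure (\<mu> k) (a k) (b k)"
    and zero_notin_interior: "k < p \<Longrightarrow> 0 \<notin> {a k<..<b k}"
    and disjoint_intervals: "Suc k < p \<Longrightarrow> {a k..b k} \<inter> {a (Suc k)..b (Suc k)} = {}"
begin

text \<open>In the variable \<open>x = z\<^sup>p\<^sup>+\<^sup>1\<close> and up to a power of \<open>z\<close>, this is the density of \<open>s\<^sub>k\<^sub>,\<^sub>k\<^sub>+\<^sub>i\<close> with respect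
to \<open>\<sigma>\<^sub>k\<close>.\<close>

primrec weight :: "nat \<Rightarrow> nat \<Rightarrow> real \<Rightarrow> real" where
  "weight 0 k = (\<lambda>t. 1)"
| "weight (Suc i) k = (\<lambda>t. t * (\<integral>u. weight i (Suc k) u / (t - u) \<partial>\<mu> (Suc k)))"

text \<open>For the reduced polynomial \<open>q\<close> of index \<open>n\<close> and \<open>l = n mod (p + 1)\<close> this is \<open>\<psi>\<^sub>n\<^sub>,\<^sub>k\<close>. The parameters \<open>l\<close>
and \<open>q\<close> are kept independent, so that different indices can be compared for the same \<open>l\<close>.\<close>

primrec psi :: "nat \<Rightarrow> real poly \<Rightarrow> nat \<Rightarrow> real \<Rightarrow> real" where
  "psi l q 0 = poly q"
| "psi l q (Suc k) = (\<lambda>x. (if k < l then 1 else x) *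
     (\<integral>t. (if k < l then t else 1) * psi l q k t / (x - t) \<partial>\<mu> k))"

definition density :: "nat \<Rightarrow> real poly \<Rightarrow> nat \<Rightarrow> real \<Rightarrow> real" where
  "density l q k t = (if k < l then t else 1) * psi l q k t"

lemma psi_Suc: "psi l q (Suc k) x = (if k < l then 1 else x) * (\<integral>t. density l q k t / (x - t) \<partial>\<mu> k)"
  by (simp add: density_def)

text \<open>The conditions that \<open>q\<close> is orthogonal to \<open>x\<^sup>s w\<^sub>j\<close> are numbered by \<open>m = j + p s\<close>. In this numbering the
conditions that define the multiple orthogonal polynomials form an interval.\<close>

definition orth :: "nat \<Rightarrow> nat \<Rightarrow> real poly \<Rightarrow> bool" where
  "orth l D q \<longleftrightarrow>
     (\<forall>m. l \<le> m \<and> m < l + D \<longrightarrow> (\<integral>t. poly q t * t ^ (m div p) * weight (m mod p) 0 t \<partial>\<mu> 0) = 0)"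

lemma weight_regular:
  "k + i < p \<Longrightarrow> weight i k \<in> borel_measurable borel \<and> continuous_on {a k..b k} (weight i k)"
proof (induction i arbitrary: k)
  case (Suc i)
  interpret interval_measure "\<mu> (Suc k)" "a (Suc k)" "b (Suc k)" using Suc.prems interval_measure by simp
  have IH: "weight i (Suc k) \<in> borel_measurable borel" "continuous_on {a (Suc k)..b (Suc k)} (weight i (Suc k))"
    using Suc.IH[of "Suc k"] Suc.prems by auto
  show ?case
    using borel_measurable_cauchy_transform[OF IH(1)] disjoint_intervals[of k] Suc.prems
      continuous_on_cauchy_transform[OF IH, of "{a k..b k}"]
    by (auto intro!: continuous_intros)
qed auto

lemmas weight_measurable = weight_regular[THEN conjunct1]
  and weight_continuous = weight_regular[THEN conjunct2]

lemma psi_measurable: "k \<le> p \<Longrightarrow> psi l q k \<in> borel_measurable borel"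
proof (induction k)
  case (Suc k)
  interpret interval_measure "\<mu> k" "a k" "b k" using Suc.prems interval_measure by simp
  have [measurable]: "psi l q k \<in> borel_measurable borel" using Suc by simp
  have "density l q k \<in> borel_measurable borel" unfolding density_def by measurable
  from borel_measurable_cauchy_transform[OF this] show ?case unfolding psi_Suc by measurable
qed (simp add: borel_measurable_continuous_onI continuous_intros)

lemma density_measurable: "k \<le> p \<Longrightarrow> density l q k \<in> borel_measurable borel"
  using psi_measurable[of k l q] unfolding density_def by measurable

lemma psi_continuous: "k < p \<Longrightarrow> continuous_on {a k..b k} (psi l q k)"
proof (induction k)
  case (Suc k)
  interpret interval_measure "\<mu> k" "a k" "b k" using Suc.prems interval_measure by simp
  have "continuous_on {a k..b k} (density l q k)"
    unfolding density_def using Suc by (cases "k < l") (auto intro!: continuous_intros)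
  then have "continuous_on {a (Suc k)..b (Suc k)} (\<lambda>x. \<integral>t. density l q k t / (x - t) \<partial>\<mu> k)"
    using density_measurable Suc.prems disjoint_intervals[of k]
    by (intro continuous_on_cauchy_transform) auto
  then show ?case unfolding psi_Suc by (cases "k < l") (auto intro!: continuous_intros)
qed (simp add: continuous_intros)

lemma density_continuous: "k < p \<Longrightarrow> continuous_on {a k..b k} (density l q k)"
  unfolding density_def using psi_continuous[of k l q] by (cases "k < l") (auto intro!: continuous_intros)

lemma notin_previous_interval:
  "Suc k < p \<Longrightarrow> x \<in> {a (Suc k)..b (Suc k)} \<Longrightarrow> x \<notin> {a k..b k}"
  using disjoint_intervals[of k] by blast

text \<open>Induction on the level. The weight at level \<open>k\<close> is \<open>t\<close> times a Cauchy transform. After exchanging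
the integrals, the inner one is a Cauchy transform of \<open>psi l q k\<close> times a power of \<open>t\<close>; that power
may be taken outside since the moments of lower order vanish, and what remains is the next
function \<open>psi l q (Suc k)\<close> times \<open>u\<^sup>s\<close>.\<close>

lemma orth_level:
  assumes "orth l D q" "l \<le> p" "k \<le> j" "j < p" "l \<le> j + p * s" "j + p * s < l + D"
  shows "(\<integral>t. psi l q k t * t ^ s * weight (j - k) k t \<partial>\<mu> k) = 0"
  using assms(3-)
proof (induction k arbitrary: j s)
  case 0
  then have "(j + p * s) div p = s" "(j + p * s) mod p = j" by auto
  then show ?case using assms(1) 0 unfolding orth_def by (metis diff_zero psi.simps(1))
next
  case (Suc k)
  then have kp: "Suc k < p" by simp
  interpret K: interval_measure "\<mu> k" "a k" "b k" using kp interval_measure by simp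
  interpret K': interval_measure "\<mu> (Suc k)" "a (Suc k)" "b (Suc k)" using kp interval_measure by simp
  let ?w = "weight (j - Suc k) (Suc k)"
  have [measurable]: "psi l q k \<in> borel_measurable borel" "density l q k \<in> borel_measurable borel"
      "?w \<in> borel_measurable borel" "psi l q (Suc k) \<in> borel_measurable borel"
    using psi_measurable density_measurable weight_measurable Suc.prems kp by auto
  have pc: "continuous_on {a k..b k} (psi l q k)" "continuous_on {a k..b k} (density l q k)"
    "continuous_on {a (Suc k)..b (Suc k)} ?w"
    using psi_continuous density_continuous weight_continuous kp Suc.prems by auto
  have moment: "(\<integral>t. psi l q k t * t ^ i \<partial>\<mu> k) = 0" if "l \<le> k + p * i" "i \<le> s" for i
  proof -
    have "k + p * i < l + D" using Suc.prems that mult_le_mono2[of i s p] by linarith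
    then show ?thesis using Suc.IH[of k i] that kp by simp
  qed
  have inner: "(\<integral>t. psi l q k t * t ^ Suc s / (u - t) \<partial>\<mu> k) = u ^ s * psi l q (Suc k) u"
    if "u \<in> {a (Suc k)..b (Suc k)}" for u
  proof (cases "k < l")
    case True
    have "(\<integral>t. density l q k t * t ^ i \<partial>\<mu> k) = 0" if "i < s" for i
    proof -
      have "p * 1 \<le> p * Suc i" by (intro mult_le_mono2) auto
      then have "l \<le> k + p * Suc i" using assms(2) by linarith
      then have "(\<integral>t. psi l q k t * t ^ Suc i \<partial>\<mu> k) = 0" using that by (intro moment) auto
      then show ?thesis using True by (simp add: density_def ac_simps)
    qed
    then have "(\<integral>t. density l q k t * t ^ s / (u - t) \<partial>\<mu> k) = u ^ s * (\<integral>t. density l q k t / (u - t) \<partial>\<mu> k)"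
      using notin_previous_interval[OF kp that] pc by (intro K.cauchy_transform_power) auto
    then show ?thesis unfolding psi_Suc using True by (simp add: density_def ac_simps)
  next
    case False
    have "(\<integral>t. psi l q k t * t ^ Suc s / (u - t) \<partial>\<mu> k) = u ^ Suc s * (\<integral>t. psi l q k t / (u - t) \<partial>\<mu> k)"
      using notin_previous_interval[OF kp that] pc False by (intro K.cauchy_transform_power moment) auto
    then show ?thesis unfolding psi_Suc using False by (simp add: density_def)
  qed
  have "0 = (\<integral>t. psi l q k t * t ^ s * weight (Suc (j - Suc k)) k t \<partial>\<mu> k)"
    using Suc.IH[of j s] Suc.prems by (simp add: Suc_diff_Suc del: weight.simps)
  also have "\<dots> = (\<integral>t. psi l q k t * t ^ Suc s * (\<integral>u. ?w u / (t - u) \<partial>\<mu> (Suc k)) \<partial>\<mu> k)"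
    by (simp add: ac_simps)
  also have "\<dots> = - (\<integral>u. ?w u * (\<integral>t. psi l q k t * t ^ Suc s / (u - t) \<partial>\<mu> k) \<partial>\<mu> (Suc k))"
    using disjoint_intervals[of k] kp pc
    by (intro swap_cauchy_transform[where a = "a k" and b = "b k" and c = "a (Suc k)" and d = "b (Suc k)"]
        K.interval_measure_axioms K'.interval_measure_axioms continuous_intros) auto
  also have "(\<integral>u. ?w u * (\<integral>t. psi l q k t * t ^ Suc s / (u - t) \<partial>\<mu> k) \<partial>\<mu> (Suc k)) =
      (\<integral>u. psi l q (Suc k) u * u ^ s * ?w u \<partial>\<mu> (Suc k))"
  proof (rule K'.integral_cong_on_interval)
    show "(\<lambda>u. ?w u * (\<integral>t. psi l q k t * t ^ Suc s / (u - t) \<partial>\<mu> k)) \<in> borel_measurable borel"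
      by (intro borel_measurable_times K.borel_measurable_cauchy_transform) measurable
  qed (use inner in \<open>auto simp: ac_simps\<close>)
  finally show ?case by simp
qed

section \<open>The system on the real line: counting zeros\<close>

text \<open>At level \<open>k\<close> the conditions with \<open>m mod p = k\<close> have weight \<open>1\<close>: they are plain moment conditions.
Only these enter the count of zeros.\<close>

definition level_count :: "nat \<Rightarrow> nat \<Rightarrow> nat \<Rightarrow> nat" where
  "level_count l D k = card {s. l \<le> k + p * s \<and> k + p * s < l + D}"

lemma finite_level: "finite {s. l \<le> k + p * s \<and> k + p * s < l + D}"
proof (rule finite_subset)
  show "{s. l \<le> k + p * s \<and> k + p * s < l + D} \<subseteq> {..<l + D}"
  proof
    fix s assume "s \<in> {s. l \<le> k + p * s \<and> k + p * s < l + D}"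
    moreover have "s \<le> p * s" using mult_le_mono1[OF p_pos, of s] by simp
    ultimately show "s \<in> {..<l + D}" unfolding lessThan_iff mem_Collect_eq by linarith
  qed
qed simp

lemma sum_level_count: "(\<Sum>k<p. level_count l D k) = D"
proof -
  have "(\<Sum>k<p. level_count l D k) = card (SIGMA k:{..<p}. {s. l \<le> k + p * s \<and> k + p * s < l + D})"
    unfolding level_count_def using finite_level by (subst card_SigmaI) auto
  also have "\<dots> = card {l..<l + D}"
  proof (rule bij_betw_same_card)
    show "bij_betw (\<lambda>(k, s). k + p * s) (SIGMA k:{..<p}. {s. l \<le> k + p * s \<and> k + p * s < l + D}) {l..<l + D}"
      by (rule bij_betw_byWitness[where f' = "\<lambda>m. (m mod p, m div p)"]) (use p_pos in auto)
  qed
  finally show ?thesis by simp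
qed

text \<open>For \<open>k < l\<close> the window starts with the exponent \<open>1\<close>, and the
factor \<open>t\<close> in the density makes up for the moment of order \<open>0\<close> that is missing.\<close>

lemma density_moments:
  assumes "orth l D q" "l \<le> p" "k < p" "s < level_count l D k"
  shows "(\<integral>t. density l q k t * t ^ s \<partial>\<mu> k) = 0"
proof -
  define A where "A = {s. l \<le> k + p * s \<and> k + p * s < l + D}"
  have moment: "(\<integral>t. psi l q k t * t ^ i \<partial>\<mu> k) = 0" if "i \<in> A" for i
    using orth_level[OF assms(1,2), of k k i] that assms(3) by (simp add: A_def)
  have down: "i \<in> A" if "j \<in> A" "i \<le> j" "l \<le> k + p * i" for i j
    using that mult_le_mono2[OF that(2), of p] unfolding A_def mem_Collect_eq by linarith
  have card: "s < card A" using assms(4) by (simp add: A_def level_count_def)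
  show ?thesis
  proof (cases "k < l")
    case True
    have "Suc s \<in> A"
    proof (rule ccontr)
      assume notin: "Suc s \<notin> A"
      have "p * 1 \<le> p * Suc s" by (intro mult_le_mono2) auto
      then have "l \<le> k + p * Suc s" using assms(2) by linarith
      then have "A \<subseteq> {..s}" using down[of _ "Suc s"] notin by (meson atMost_iff not_less_eq_eq subsetI)
      moreover have "0 \<notin> A" using True by (simp add: A_def)
      ultimately have "A \<subseteq> {1..s}" by (metis One_nat_def Suc_leI atLeastAtMost_iff atMost_iff bot_nat_0.not_eq_extremum subset_eq)
      then have "card A \<le> s" using card_mono[of "{1..s}" A] by simp
      then show False using card by simp
    qed
    from moment[OF this] True show ?thesis by (simp add: density_def ac_simps)
  next
    case False
    have "s \<in> A"
    proof (rule ccontr)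
      assume notin: "s \<notin> A"
      have "l \<le> k + p * s" using False by simp
      then have "A \<subseteq> {..<s}" using down[of _ "s"] notin by (meson lessThan_iff not_less subsetI)
      then have "card A \<le> s" using card_mono[of "{..<s}" A] by simp
      then show False using card by simp
    qed
    from moment[OF this] False show ?thesis by (simp add: density_def)
  qed
qed

definition zeros :: "nat \<Rightarrow> real poly \<Rightarrow> nat \<Rightarrow> real set" where
  "zeros l q k = {x \<in> {a k<..<b k}. psi l q k x = 0}"

definition sign_changes :: "nat \<Rightarrow> real poly \<Rightarrow> nat \<Rightarrow> real set" where
  "sign_changes l q k = {x \<in> {a k<..<b k}. sign_change (psi l q k) x}"

lemma sign_changes_subset_zeros:
  assumes "k < p"
  shows "sign_changes l q k \<subseteq> zeros l q k"
proof
  fix x assume x: "x \<in> sign_changes l q k"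
  then have "isCont (psi l q k) x"
    using psi_continuous[OF assms, of l q] by (auto simp: sign_changes_def intro: continuous_on_interior)
  then show "x \<in> zeros l q k"
    using x sign_change_imp_zero by (auto simp: sign_changes_def zeros_def)
qed

text \<open>The moment conditions of level \<open>k\<close> and the zeros of the Cauchy transform of the density, collected
in \<open>X\<close> with their multiplicities, make the density orthogonal to a space of rational functions
of dimension \<open>size X + level_count l D k\<close>.\<close>

lemma sign_changes_from_poles:
  assumes orth: "orth l D q" "l \<le> p" and k: "k < p" and fin: "finite (zeros l q k)"
    and X: "set_mset X \<inter> {a k..b k} = {}"
    and poles: "\<And>x j. x \<in># X \<Longrightarrow> 1 \<le> j \<Longrightarrow> j \<le> count X x \<Longrightarrow> (\<integral>t. density l q k t / (x - t) ^ j \<partial>\<mu> k) = 0"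
  shows "size X + level_count l D k \<le> card (sign_changes l q k)"
proof -
  interpret interval_measure "\<mu> k" "a k" "b k" using k interval_measure by simp
  have nz: "x \<noteq> 0" if "x \<in> {a k<..<b k}" for x using zero_notin_interior[OF k] that by metis
  have zeros: "{x \<in> {a k<..<b k}. density l q k x = 0} = zeros l q k"
    using nz by (auto simp: density_def zeros_def)
  have "sign_change (density l q k) x \<longleftrightarrow> sign_change (psi l q k) x" if "x \<in> {a k<..<b k}" for x
  proof (cases "k < l")
    case True
    then have "density l q k = (\<lambda>t. psi l q k t * t)" by (auto simp: density_def)
    then show ?thesis using sign_change_mult_iff[where g = "\<lambda>t. t" and c = x and f = "psi l q k"] nz[OF that] by simp
  next
    case False
    then have "density l q k = psi l q k" by (auto simp: density_def)
    then show ?thesis by simp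
  qed
  then have sc: "{x \<in> {a k<..<b k}. sign_change (density l q k) x} = sign_changes l q k"
    by (auto simp: sign_changes_def)
  define P where "P = (\<Prod>x\<in>#X. [:- x, 1:])"
  have "size X + level_count l D k \<le> card {x \<in> {a k<..<b k}. sign_change (density l q k) x}"
  proof (rule orthogonal_imp_sign_changes)
    show "poly P x \<noteq> 0" if "x \<in> {a k..b k}" for x
      using that X by (auto simp: P_def poly_prod_mset prod_mset_zero_iff image_iff)
    show "(\<integral>t. density l q k t * poly r t / poly P t \<partial>\<mu> k) = 0" if "degree r < size X + level_count l D k" for r
      unfolding P_def
      by (rule orthogonal_to_rational[where m = "level_count l D k"])
        (use k density_measurable density_continuous density_moments[OF orth k] X poles that in auto)
  qed (use zeros fin k density_measurable density_continuous in auto)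
  then show ?thesis unfolding sc .
qed

lemma cauchy_zero_if_psi_zero:
  assumes "Suc k < p" "x \<in> zeros l q (Suc k)"
  shows "(\<integral>t. density l q k t / (x - t) \<partial>\<mu> k) = 0" "x \<notin> {a k..b k}" "x \<noteq> 0"
proof -
  have x: "x \<in> {a (Suc k)<..<b (Suc k)}" "psi l q (Suc k) x = 0" using assms by (auto simp: zeros_def)
  show "x \<notin> {a k..b k}" using notin_previous_interval[OF assms(1), of x] x by auto
  show "x \<noteq> 0" using zero_notin_interior[OF assms(1)] x by metis
  then show "(\<integral>t. density l q k t / (x - t) \<partial>\<mu> k) = 0"
    using x(2) unfolding psi_Suc by (auto split: if_splits)
qed

lemma zeros_transfer_down:
  assumes orth: "orth l D q" "l \<le> p" and k: "Suc k < p" and fin: "finite (zeros l q k)"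
    and Y: "finite Y" "Y \<subseteq> zeros l q (Suc k)"
  shows "card Y + level_count l D k \<le> card (sign_changes l q k)"
proof -
  have *: "size (mset_set Y) + level_count l D k \<le> card (sign_changes l q k)"
  proof (rule sign_changes_from_poles[OF orth _ fin])
    show "set_mset (mset_set Y) \<inter> {a k..b k} = {}"
      using Y cauchy_zero_if_psi_zero(2)[OF k] by (meson disjoint_iff elem_mset_set subsetD)
    fix x j assume x: "x \<in># mset_set Y" "1 \<le> j" "j \<le> count (mset_set Y) x"
    then have "j = 1" using Y(1) by auto
    then show "(\<integral>t. density l q k t / (x - t) ^ j \<partial>\<mu> k) = 0"
      using x Y cauchy_zero_if_psi_zero[OF k] by auto
  qed (use k in simp)
  then show ?thesis by simp
qed

text \<open>Zeros are pushed down to the polynomial at level \<open>0\<close>. Finiteness is part of the induction because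
the sign argument at level \<open>k\<close> presupposes it.\<close>

lemma zeros_bound:
  assumes orth: "orth l D q" "l \<le> p" and q: "q \<noteq> 0"
  shows "k < p \<Longrightarrow> finite (zeros l q k) \<and> card (zeros l q k) + (\<Sum>i<k. level_count l D i) \<le> degree q"
proof (induction k)
  case 0
  have fin: "finite {x. poly q x = 0}" using q by (rule poly_roots_finite)
  then have "card (zeros l q 0) \<le> card {x. poly q x = 0}" by (intro card_mono) (auto simp: zeros_def)
  also have "\<dots> \<le> degree q" using q by (rule card_poly_roots_bound)
  finally show ?case using finite_subset[OF _ fin, of "zeros l q 0"] by (auto simp: zeros_def)
next
  case (Suc k)
  then have IH: "finite (zeros l q k)" "card (zeros l q k) + (\<Sum>i<k. level_count l D i) \<le> degree q" by auto
  have sub: "card (sign_changes l q k) \<le> card (zeros l q k)"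
    using sign_changes_subset_zeros[of k l q] IH(1) Suc.prems by (intro card_mono) auto
  have *: "card Y + level_count l D k \<le> card (zeros l q k)" if "Y \<subseteq> zeros l q (Suc k)" "finite Y" for Y
    using zeros_transfer_down[OF orth Suc.prems IH(1) that(2,1)] sub by linarith
  have "card Y \<le> card (zeros l q k)" if "Y \<subseteq> zeros l q (Suc k)" "finite Y" for Y
    using *[OF that] by simp
  then have fin: "finite (zeros l q (Suc k))"
    using finite_if_finite_subsets_card_bdd[of "zeros l q (Suc k)" "card (zeros l q k)"] by blast
  then show ?case using *[OF order_refl fin] IH by simp
qed

lemma finite_zeros: "orth l D q \<Longrightarrow> l \<le> p \<Longrightarrow> q \<noteq> 0 \<Longrightarrow> k < p \<Longrightarrow> finite (zeros l q k)"
  using zeros_bound by blast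

text \<open>Starting with no zeros at all beyond the last level, each step down gains \<open>level_count l D k\<close> sign
changes.\<close>

lemma sign_changes_bound:
  assumes orth: "orth l D q" "l \<le> p" and q: "q \<noteq> 0" and k: "k < p"
  shows "(\<Sum>i=k..<p. level_count l D i) \<le> card (sign_changes l q k)"
proof -
  have "k \<le> p - 1" using k by simp
  then show ?thesis
  proof (induction k rule: inc_induct)
    case base
    have fin: "finite (zeros l q (p - 1))" by (rule finite_zeros[OF orth q]) (use p_pos in simp)
    have "size ({#} :: real multiset) + level_count l D (p - 1) \<le> card (sign_changes l q (p - 1))"
      by (rule sign_changes_from_poles[OF orth _ fin]) (use p_pos in auto)
    moreover have "{p - 1..<p} = {p - 1}" using p_pos by auto
    ultimately show ?case by simp
  next
    case (step k)
    have k: "Suc k < p" using step by simp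
    have sub: "sign_changes l q (Suc k) \<subseteq> zeros l q (Suc k)" using sign_changes_subset_zeros k by simp
    have "card (sign_changes l q (Suc k)) + level_count l D k \<le> card (sign_changes l q k)"
      using finite_zeros[OF orth q] k finite_subset[OF sub]
      by (intro zeros_transfer_down[OF orth k _ _ sub]) auto
    then show ?case using step.IH k by (subst sum.atLeast_Suc_lessThan) auto
  qed
qed

text \<open>This is normality: a nonzero polynomial cannot satisfy more conditions than its degree.\<close>

lemma degree_lower_bound:
  assumes orth: "orth l D q" "l \<le> p" and q: "q \<noteq> 0"
  shows "D \<le> degree q"
proof -
  have p: "0 < p" using p_pos by simp
  have "D \<le> card (sign_changes l q 0)"
    using sign_changes_bound[OF orth q p] sum_level_count[of l D] by (simp add: atLeast0LessThan)
  also have "\<dots> \<le> card (zeros l q 0)"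
    using sign_changes_subset_zeros[OF p] finite_zeros[OF orth q p] by (intro card_mono)
  also have "\<dots> \<le> degree q" using zeros_bound[OF orth q p] by simp
  finally show ?thesis .
qed

lemma integrable_orth_term:
  "integrable (\<mu> 0) (\<lambda>t. poly q t * t ^ i * weight (m mod p) 0 t)"
proof -
  have m: "m mod p < p" using p_pos by simp
  interpret interval_measure "\<mu> 0" "a 0" "b 0" using p_pos interval_measure by simp
  have [measurable]: "weight (m mod p) 0 \<in> borel_measurable borel" using weight_measurable[of 0 "m mod p"] m by simp
  show ?thesis using weight_continuous[of 0 "m mod p"] m
    by (intro integrable_if_continuous continuous_intros) auto
qed

lemma orth_linear:
  assumes "orth l D q1" "orth l D q2"
  shows "orth l D (smult A q1 + smult B q2)"
  unfolding orth_def
proof (intro allI impI)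
  fix m assume m: "l \<le> m \<and> m < l + D"
  have "(\<integral>t. poly (smult A q1 + smult B q2) t * t ^ (m div p) * weight (m mod p) 0 t \<partial>\<mu> 0) =
    (\<integral>t. A * (poly q1 t * t ^ (m div p) * weight (m mod p) 0 t) +
      B * (poly q2 t * t ^ (m div p) * weight (m mod p) 0 t) \<partial>\<mu> 0)"
    by (simp add: algebra_simps)
  also have "\<dots> = A * (\<integral>t. poly q1 t * t ^ (m div p) * weight (m mod p) 0 t \<partial>\<mu> 0) +
      B * (\<integral>t. poly q2 t * t ^ (m div p) * weight (m mod p) 0 t \<partial>\<mu> 0)"
    using integrable_orth_term by simp
  also have "\<dots> = 0" using assms m unfolding orth_def by simp
  finally show "(\<integral>t. poly (smult A q1 + smult B q2) t * t ^ (m div p) * weight (m mod p) 0 t \<partial>\<mu> 0) = 0" .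
qed

lemma orth_subwindow:
  "orth l D q \<Longrightarrow> l \<le> l' \<Longrightarrow> l' + D' \<le> l + D \<Longrightarrow> orth l' D' q"
  unfolding orth_def by auto

lemma orth_times_variable: "orth 0 D (pCons 0 q) \<longleftrightarrow> orth p D q"
proof -
  have *: "(\<integral>t. poly (pCons 0 q) t * t ^ (m div p) * weight (m mod p) 0 t \<partial>\<mu> 0) =
      (\<integral>t. poly q t * t ^ ((p + m) div p) * weight ((p + m) mod p) 0 t \<partial>\<mu> 0)" for m
  proof -
    have "(p + m) div p = Suc (m div p)" "(p + m) mod p = m mod p" using p_pos by auto
    then show ?thesis by (simp add: ac_simps)
  qed
  have "(\<forall>m. p \<le> m \<and> m < p + D \<longrightarrow> Q m) \<longleftrightarrow> (\<forall>m<D. Q (p + m))" for Q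
    by (metis add_less_cancel_left le_add1 le_Suc_ex)
  then show ?thesis unfolding orth_def * by simp
qed

lemma orth_exists: "\<exists>q. q \<noteq> 0 \<and> degree q \<le> D \<and> orth l D q"
proof -
  define L where "L = (\<lambda>j i. \<integral>t. poly (monom 1 i) t * t ^ ((l + j) div p) * weight ((l + j) mod p) 0 t \<partial>\<mu> 0)"
  obtain c where c: "\<exists>i\<in>{..D}. c i \<noteq> 0" "\<And>j. j < D \<Longrightarrow> (\<Sum>i\<in>{..D}. L j i * c i) = 0"
    using homogeneous_system_nontrivial_solution[of "{..D}" D L] by auto
  define q where "q = (\<Sum>i\<le>D. monom (c i) i)"
  have coeff: "coeff q i = (if i \<le> D then c i else 0)" for i
    by (simp add: q_def coeff_sum coeff_monom)
  have "q \<noteq> 0" using c(1) coeff by (metis atMost_iff coeff_0)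
  moreover have "degree q \<le> D" using coeff by (intro degree_le) auto
  moreover have "orth l D q"
    unfolding orth_def
  proof (intro allI impI)
    fix m assume m: "l \<le> m \<and> m < l + D"
    define j where "j = m - l"
    have j: "m = l + j" "j < D" using m by (auto simp: j_def)
    have "(\<integral>t. poly q t * t ^ (m div p) * weight (m mod p) 0 t \<partial>\<mu> 0) =
      (\<integral>t. (\<Sum>i\<le>D. c i * (poly (monom 1 i) t * t ^ (m div p) * weight (m mod p) 0 t)) \<partial>\<mu> 0)"
      by (simp add: q_def poly_sum poly_monom sum_distrib_right sum_distrib_left ac_simps)
    also have "\<dots> = (\<Sum>i\<le>D. c i * (\<integral>t. poly (monom 1 i) t * t ^ (m div p) * weight (m mod p) 0 t \<partial>\<mu> 0))"
      using integrable_orth_term by simp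
    also have "\<dots> = 0" using c(2)[OF j(2)] by (simp add: L_def j(1) mult.commute)
    finally show "(\<integral>t. poly q t * t ^ (m div p) * weight (m mod p) 0 t \<partial>\<mu> 0) = 0" .
  qed
  ultimately show ?thesis by blast
qed

lemma orth_monic_exists:
  assumes "l \<le> p"
  shows "\<exists>q. lead_coeff q = 1 \<and> degree q = D \<and> orth l D q"
proof -
  obtain q where q: "q \<noteq> 0" "degree q \<le> D" "orth l D q" using orth_exists by blast
  then have deg: "degree q = D" using degree_lower_bound[OF q(3) assms q(1)] by simp
  define r where "r = smult (1 / lead_coeff q) q"
  have "orth l D r" using orth_linear[OF q(3) q(3), of "1 / lead_coeff q" 0] by (simp add: r_def)
  moreover have "lead_coeff q \<noteq> 0" using q(1) by simp
  ultimately show ?thesis using deg by (intro exI[of _ r]) (simp add: r_def)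
qed

lemma psi_linear:
  "k < p \<Longrightarrow> x \<in> {a k..b k} \<Longrightarrow>
    psi l (smult A q1 + smult B q2) k x = A * psi l q1 k x + B * psi l q2 k x"
proof (induction k arbitrary: x)
  case (Suc k)
  then have k: "k < p" by simp
  interpret interval_measure "\<mu> k" "a k" "b k" using k interval_measure by simp
  have x: "x \<notin> {a k..b k}" using notin_previous_interval Suc.prems by blast
  have [measurable]: "density l q k \<in> borel_measurable borel" for q using density_measurable k by simp
  have int: "integrable (\<mu> k) (\<lambda>t. density l q k t / (x - t))" for q
    using density_continuous[OF k] x by (intro integrable_if_continuous continuous_intros) auto
  have "(\<integral>t. density l (smult A q1 + smult B q2) k t / (x - t) \<partial>\<mu> k) =
     (\<integral>t. A * (density l q1 k t / (x - t)) + B * (density l q2 k t / (x - t)) \<partial>\<mu> k)"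
  proof (rule integral_cong_on_interval)
    fix t assume "t \<in> {a k..b k}"
    then have "density l (smult A q1 + smult B q2) k t = A * density l q1 k t + B * density l q2 k t"
      unfolding density_def by (subst Suc.IH[OF k]) (auto simp: distrib_left)
    then show "density l (smult A q1 + smult B q2) k t / (x - t) =
        A * (density l q1 k t / (x - t)) + B * (density l q2 k t / (x - t))"
      by (simp add: add_divide_distrib)
  qed measurable
  also have "\<dots> = A * (\<integral>t. density l q1 k t / (x - t) \<partial>\<mu> k) + B * (\<integral>t. density l q2 k t / (x - t) \<partial>\<mu> k)"
    using int by (simp del: times_divide_eq_right)
  finally show ?case unfolding psi_Suc by (simp add: algebra_simps)
qed simp

text \<open>For \<open>l = p\<close> the variable is inside the integral at every level, for \<open>l = 0\<close> it is always outside.\<close>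

lemma psi_times_variable: "k \<le> p \<Longrightarrow> psi 0 (pCons 0 q) k x = x * psi p q k x"
proof (induction k arbitrary: x)
  case (Suc k)
  then have "density 0 (pCons 0 q) k = density p q k" by (auto simp: density_def fun_eq_iff)
  then show ?case using Suc.prems unfolding psi_Suc by simp
qed simp

text \<open>The recursions for \<open>l\<close> and \<open>Suc l\<close> differ only in the step from level \<open>l\<close> to level \<open>Suc l\<close>, where the
variable is outside or inside the integral. The difference of the two is the integral of
\<open>psi l q l\<close>, which vanishes by the first condition of the window.\<close>

lemma psi_shift:
  assumes "orth l D q" "1 \<le> D" "l < p"
  shows "k < p \<Longrightarrow> x \<in> {a k..b k} \<Longrightarrow> psi (Suc l) q k x = psi l q k x"
proof (induction k arbitrary: x)
  case (Suc k)
  then have k: "k < p" by simp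
  interpret interval_measure "\<mu> k" "a k" "b k" using k interval_measure by simp
  have x: "x \<notin> {a k..b k}" using notin_previous_interval Suc.prems by blast
  have [measurable]: "density l q k \<in> borel_measurable borel" for l q using density_measurable k by simp
  have [measurable]: "psi l q k \<in> borel_measurable borel" for l q using psi_measurable k by simp
  show ?case
  proof (cases "k = l")
    case True
    have "(\<integral>t. psi l q k t * t ^ 0 * weight (k - k) k t \<partial>\<mu> k) = 0"
      using assms k True by (intro orth_level[OF assms(1)]) auto
    then have "(\<integral>t. psi l q k t * t ^ 1 / (x - t) \<partial>\<mu> k) = x ^ 1 * (\<integral>t. psi l q k t / (x - t) \<partial>\<mu> k)"
      using psi_continuous[OF k] x by (intro cauchy_transform_power) auto
    moreover have "(\<integral>t. density (Suc l) q k t / (x - t) \<partial>\<mu> k) = (\<integral>t. psi l q k t * t ^ 1 / (x - t) \<partial>\<mu> k)"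
    proof (rule integral_cong_on_interval)
      fix t assume "t \<in> {a k..b k}"
      then show "density (Suc l) q k t / (x - t) = psi l q k t * t ^ 1 / (x - t)"
        using Suc.IH[OF k] True by (simp add: density_def)
    qed measurable
    ultimately show ?thesis using True unfolding psi_Suc by (simp add: density_def)
  next
    case False
    then have less: "k < Suc l \<longleftrightarrow> k < l" by auto
    have "(\<integral>t. density (Suc l) q k t / (x - t) \<partial>\<mu> k) = (\<integral>t. density l q k t / (x - t) \<partial>\<mu> k)"
      by (rule integral_cong_on_interval) (use Suc.IH[OF k] in \<open>auto simp: density_def less\<close>)
    then show ?thesis unfolding psi_Suc less by simp
  qed
qed simp

lemma psi_Suc_has_derivative:
  assumes "k < p" "x \<notin> {a k..b k}"
  shows "(psi l q (Suc k) has_real_derivative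
     (if k < l then 0 else (\<integral>t. density l q k t / (x - t) \<partial>\<mu> k))
       - (if k < l then 1 else x) * (\<integral>t. density l q k t / (x - t)\<^sup>2 \<partial>\<mu> k)) (at x)"
proof -
  interpret interval_measure "\<mu> k" "a k" "b k" using assms interval_measure by simp
  have F: "((\<lambda>y. \<integral>t. density l q k t / (y - t) \<partial>\<mu> k) has_real_derivative - (\<integral>t. density l q k t / (x - t)\<^sup>2 \<partial>\<mu> k)) (at x)"
    using assms density_measurable density_continuous by (intro has_derivative_cauchy_transform) auto
  show ?thesis
  proof (cases "k < l")
    case True
    then have "psi l q (Suc k) = (\<lambda>y. \<integral>t. density l q k t / (y - t) \<partial>\<mu> k)" by (auto simp: density_def)
    then show ?thesis using F True by simp
  next
    case False
    then have "psi l q (Suc k) = (\<lambda>y. y * (\<integral>t. density l q k t / (y - t) \<partial>\<mu> k))" by (auto simp: density_def)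
    then show ?thesis using DERIV_mult[OF DERIV_ident F] False by (simp only: if_False) (simp add: mult.commute)
  qed
qed

lemma psi_differentiable:
  assumes "k < p" "x \<in> {a k<..<b k}"
  shows "(psi l q k has_real_derivative deriv (psi l q k) x) (at x)"
proof (cases k)
  case 0
  then show ?thesis using poly_DERIV[of q x] DERIV_imp_deriv by fastforce
next
  case (Suc j)
  then have "x \<notin> {a j..b j}" using notin_previous_interval[of j x] assms by auto
  then show ?thesis using psi_Suc_has_derivative[of j x l q] assms(1) Suc DERIV_imp_deriv by fastforce
qed

text \<open>The analogue for polynomials of \<open>triple_zero_if_double_zero_sign_change\<close>.\<close>

lemma sign_change_at_double_root_imp_triple:
  fixes r :: "real poly"
  assumes "sign_change (poly ([:- x, 1:]\<^sup>2 * r)) x"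
  shows "poly r x = 0"
proof (rule ccontr)
  assume r: "poly r x \<noteq> 0"
  have "poly ([:- x, 1:]\<^sup>2 * r) = (\<lambda>t. (t - x)\<^sup>2 * poly r t)" by (auto simp: power2_eq_square algebra_simps)
  then have "sign_change (\<lambda>t. (t - x)\<^sup>2) x"
    using assms sign_change_mult_iff[where g = "poly r" and c = x and f = "\<lambda>t. (t - x)\<^sup>2"] r by (simp add: continuous_intros)
  then obtain d where "d > 0" "\<And>u v. x - d < u \<Longrightarrow> u < x \<Longrightarrow> x < v \<Longrightarrow> v < x + d \<Longrightarrow> (u - x)\<^sup>2 * (v - x)\<^sup>2 < 0"
    unfolding sign_change_def by blast
  from this(2)[of "x - d/2" "x + d/2"] this(1) show False by (simp add: mult_less_0_iff)
qed

text \<open>Suppose that \<open>x\<close> is a multiple zero. Counting all sign changes once and \<open>x\<close> twice more is justified: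
a multiple zero at which the function changes sign has order at least three. The resulting
number of zeros exceeds the lower bound for the number of sign changes by two, whereas the upper
bound for the number of zeros exceeds it by at most one.\<close>

lemma simple_zeros:
  assumes orth: "orth l D q" "l \<le> p" and q: "q \<noteq> 0" and deg: "degree q \<le> Suc D"
    and k: "k < p" and x: "x \<in> zeros l q k"
  shows "\<not> (psi l q k has_real_derivative 0) (at x)"
proof
  assume der: "(psi l q k has_real_derivative 0) (at x)"
  define S where "S = sign_changes l q k"
  have "S \<subseteq> zeros l q k" unfolding S_def using k by (rule sign_changes_subset_zeros)
  then have S: "finite S" "S \<subseteq> zeros l q k" using finite_zeros[OF orth q k] finite_subset by auto
  \<comment> \<open>if \<open>x\<close> is itself a sign change, it is counted three times\<close>
  define X where "X = mset_set S + {#x, x#}"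
  have setX: "set_mset X \<subseteq> zeros l q k" using S x by (auto simp: X_def)
  have countX: "count X y = (if y \<in> S then 1 else 0) + (if y = x then 2 else 0)" for y
    using S(1) by (auto simp: X_def count_mset_set')
  have sizeX: "size X = card S + 2" by (simp add: X_def)
  have low: "(\<Sum>i=k..<p. level_count l D i) \<le> card S" unfolding S_def by (rule sign_changes_bound[OF orth q k])
  have split: "(\<Sum>i<k. level_count l D i) + (\<Sum>i=k..<p. level_count l D i) = D"
    using sum_level_count[of l D] k sum.atLeastLessThan_concat[of 0 k p "level_count l D"]
    by (simp add: atLeast0LessThan)
  show False
  proof (cases k)
    case 0
    have psi: "psi l q k = poly q" using 0 by simp
    have px: "poly q x = 0" using x 0 by (simp add: zeros_def)
    then obtain r where r: "q = [:- x, 1:] * r" unfolding poly_eq_0_iff_dvd dvd_def by blast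
    have "poly (pderiv q) x = 0" using der DERIV_unique[OF poly_DERIV] unfolding psi by metis
    then have "poly r x = 0" unfolding r pderiv_mult by (simp add: pderiv_pCons del: mult_pCons_left)
    then obtain r2 where "r = [:- x, 1:] * r2" unfolding poly_eq_0_iff_dvd dvd_def by blast
    then have r2: "q = [:- x, 1:]\<^sup>2 * r2" unfolding r power2_eq_square by (simp only: mult.assoc)
    have "X \<subseteq># proots q"
    proof (rule mset_subset_eqI)
      fix y
      have "count X y \<le> order y q"
      proof (cases "y = x")
        case True
        have "[:- x, 1:] ^ count X x dvd q"
        proof (cases "x \<in> S")
          case True
          then have "sign_change (poly ([:- x, 1:]\<^sup>2 * r2)) x" unfolding r2[symmetric] S_def psi[symmetric] sign_changes_def by simp
          then have "poly r2 x = 0" by (rule sign_change_at_double_root_imp_triple)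
          then have "[:- x, 1:]\<^sup>2 * [:- x, 1:] dvd q" unfolding r2 by (intro mult_dvd_mono) (auto simp: poly_eq_0_iff_dvd)
          moreover have "[:- x, 1:]\<^sup>2 * [:- x, 1:] = [:- x, 1:] ^ 3" by (simp add: power2_eq_square power3_eq_cube)
          ultimately show ?thesis using True by (simp add: countX numeral_3_eq_3)
        next
          case False
          then have "count X x = 2" by (simp add: countX)
          then show ?thesis using dvd_triv_left[of "[:- x, 1:]\<^sup>2" r2] unfolding r2[symmetric] by simp
        qed
        then show ?thesis using q True by (simp only: order_divides simp_thms)
      next
        case False
        show ?thesis
        proof (cases "y \<in> S")
          case True
          then have "poly q y = 0" using S 0 by (auto simp: zeros_def)
          then have "order y q \<noteq> 0" using q order_root by blast
          then show ?thesis using False by (simp add: countX)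
        qed (use False in \<open>simp add: countX\<close>)
      qed
      then show "count X y \<le> count (proots q) y" using q by simp
    qed
    then have "size X \<le> degree q" using size_mset_mono size_proots_le_degree[OF q] le_trans by blast
    then show False using sizeX low split deg 0 by simp
  next
    case (Suc j)
    have j: "Suc j < p" "j < p" using k Suc by auto
    interpret interval_measure "\<mu> j" "a j" "b j" using j interval_measure by simp
    have zero: "(\<integral>t. density l q j t / (x - t) \<partial>\<mu> j) = 0" and xj: "x \<notin> {a j..b j}" and x0: "x \<noteq> 0"
      using cauchy_zero_if_psi_zero[OF j(1)] x Suc by auto
    have zero2: "(\<integral>t. density l q j t / (x - t)\<^sup>2 \<partial>\<mu> j) = 0"
      using DERIV_unique[OF psi_Suc_has_derivative[OF j(2) xj] der[unfolded Suc]] zero x0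
      by (auto split: if_splits)
    have zero3: "(\<integral>t. density l q j t / (x - t) ^ 3 \<partial>\<mu> j) = 0" if "x \<in> S"
    proof (rule triple_zero_if_double_zero_sign_change)
      have sc: "sign_change (psi l q (Suc j)) x" using that by (simp add: S_def sign_changes_def Suc)
      show "sign_change (\<lambda>y. \<integral>t. density l q j t / (y - t) \<partial>\<mu> j) x"
      proof (cases "j < l")
        case True
        then have "psi l q (Suc j) = (\<lambda>y. \<integral>t. density l q j t / (y - t) \<partial>\<mu> j)" by (auto simp: density_def)
        then show ?thesis using sc by simp
      next
        case False
        then have "psi l q (Suc j) = (\<lambda>y. (\<integral>t. density l q j t / (y - t) \<partial>\<mu> j) * y)" by (auto simp: density_def)
        then show ?thesis using sc x0 sign_change_mult_iff[where g = "\<lambda>y. y" and c = x] by simp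
      qed
    qed (use density_measurable density_continuous j xj zero zero2 in auto)
    have "size X + level_count l D j \<le> card (sign_changes l q j)"
    proof (rule sign_changes_from_poles[OF orth j(2) finite_zeros[OF orth q j(2)]])
      show "set_mset X \<inter> {a j..b j} = {}"
        using setX cauchy_zero_if_psi_zero(2)[OF j(1)] Suc by blast
      fix y i assume y: "y \<in># X" "1 \<le> i" "i \<le> count X y"
      have z: "(\<integral>t. density l q j t / (y - t) \<partial>\<mu> j) = 0"
        using y(1) setX cauchy_zero_if_psi_zero(1)[OF j(1)] Suc by blast
      consider "i = 1" | "y = x" "i = 2" | "y = x" "i = 3" "x \<in> S"
        using y(2,3) unfolding countX by (cases "y = x"; cases "y \<in> S"; force)
      then show "(\<integral>t. density l q j t / (y - t) ^ i \<partial>\<mu> j) = 0"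
        by cases (use z zero2 zero3 in auto)
    qed
    also have "\<dots> \<le> card (zeros l q j)"
      using sign_changes_subset_zeros[OF j(2)] finite_zeros[OF orth q j(2)] by (intro card_mono)
    finally have "size X + level_count l D j + (\<Sum>i<j. level_count l D i) \<le> degree q"
      using zeros_bound[OF orth q j(2)] by linarith
    then show False using sizeX low split deg by (simp add: Suc)
  qed
qed

lemma zero_between_zeros:
  assumes orth: "orth l D q1" "orth l D q2" and l: "l \<le> p"
    and deg: "degree q1 \<le> Suc D" "degree q2 \<le> Suc D"
    and indep: "\<And>A B. A \<noteq> 0 \<or> B \<noteq> 0 \<Longrightarrow> smult A q1 + smult B q2 \<noteq> 0"
    and k: "k < p" and xy: "x \<in> zeros l q1 k" "y \<in> zeros l q1 k" "x < y"
  shows "\<exists>z\<in>zeros l q2 k. x < z \<and> z < y"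
proof -
  have "\<exists>z. x < z \<and> z < y \<and> psi l q2 k z = 0"
  proof (rule zero_between_zeros_of_simple_pencil)
    fix z assume z: "z \<in> {a k<..<b k}"
    show "(psi l q1 k has_real_derivative deriv (psi l q1 k) z) (at z)"
      "(psi l q2 k has_real_derivative deriv (psi l q2 k) z) (at z)"
      using psi_differentiable[OF k z] by auto
  next
    fix A B z
    assume AB: "A \<noteq> 0 \<or> B \<noteq> 0" and z: "z \<in> {a k<..<b k}"
      and zero: "A * psi l q1 k z + B * psi l q2 k z = 0"
    define q where "q = smult A q1 + smult B q2"
    have psi: "psi l q k t = A * psi l q1 k t + B * psi l q2 k t" if "t \<in> {a k<..<b k}" for t
      unfolding q_def by (rule psi_linear) (use k that in auto)
    have "degree q \<le> Suc D"
      unfolding q_def using deg by (intro degree_add_le order_trans[OF degree_smult_le])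
    then have "\<not> (psi l q k has_real_derivative 0) (at z)"
      using simple_zeros[of l D q k z] orth_linear[OF orth] l indep[OF AB] k z zero psi
      by (auto simp: q_def zeros_def)
    moreover have "(psi l q k has_real_derivative A * deriv (psi l q1 k) z + B * deriv (psi l q2 k) z) (at z)"
    proof (rule has_field_derivative_transform_within_open[where S = "{a k<..<b k}"])
      show "((\<lambda>t. A * psi l q1 k t + B * psi l q2 k t) has_real_derivative
          A * deriv (psi l q1 k) z + B * deriv (psi l q2 k) z) (at z)"
        by (intro DERIV_add DERIV_cmult psi_differentiable k z)
    qed (use z psi in auto)
    ultimately show "A * deriv (psi l q1 k) z + B * deriv (psi l q2 k) z \<noteq> 0" by auto
  qed (use xy in \<open>auto simp: zeros_def\<close>)
  then obtain z where "x < z" "z < y" "psi l q2 k z = 0" by blast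
  then show ?thesis using xy by (intro bexI[of _ z]) (auto simp: zeros_def)
qed

end

section \<open>Rotation-invariant measures on a star\<close>

text \<open>On a star the power \<open>t\<^sup>p\<^sup>+\<^sup>1\<close> is real; the real part makes this a real-valued function on the plane.\<close>

definition star_coord :: "nat \<Rightarrow> complex \<Rightarrow> real" where
  "star_coord p t = Re (t ^ (p + 1))"

lemma star_coord_measurable [measurable]: "star_coord p \<in> borel_measurable borel"
  unfolding star_coord_def by (intro borel_measurable_continuous_onI continuous_intros)

lemma star_coord_star: "t \<in> star p \<alpha> \<beta> \<Longrightarrow> star_coord p t \<in> {\<alpha>..\<beta>} \<and> of_real (star_coord p t) = t ^ (p + 1)"
  unfolding star_def star_coord_def mem_Collect_eq by (metis (no_types, lifting) Re_complex_of_real imageE)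

lemma closed_star: "closed (star p \<alpha> \<beta>)"
proof -
  have "closed ((\<lambda>z::complex. z ^ (p + 1)) -` (complex_of_real ` {\<alpha>..\<beta>}))"
    by (intro continuous_closed_vimage compact_imp_closed compact_continuous_image continuous_intros) auto
  then show ?thesis by (simp add: star_def vimage_def)
qed

lemma compact_star: "compact (star p \<alpha> \<beta>)"
proof -
  define C where "C = max \<bar>\<alpha>\<bar> \<bar>\<beta>\<bar>"
  have "norm t \<le> 1 + C" if "t \<in> star p \<alpha> \<beta>" for t
  proof (rule ccontr)
    assume "\<not> norm t \<le> 1 + C"
    then have t: "norm t > 1 + C" "norm t \<ge> 1" by (auto simp: C_def)
    have "norm t ^ 1 \<le> norm t ^ (p + 1)" using t by (intro power_increasing) auto
    also have "\<dots> = \<bar>star_coord p t\<bar>"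
      using star_coord_star[OF that] by (metis norm_of_real norm_power)
    also have "\<dots> \<le> C" using star_coord_star[OF that] by (auto simp: C_def)
    finally show False using t by simp
  qed
  then have "bounded (star p \<alpha> \<beta>)" unfolding bounded_iff by blast
  then show ?thesis using closed_star compact_eq_bounded_closed by blast
qed

locale invariant_star_measure = finite_measure S for S :: "complex measure" +
  fixes p :: nat and a b :: real
  assumes sets_S [measurable_cong]: "sets S = sets borel"
    and a_less_b: "a < b"
    and AE_in_star: "AE t in S. t \<in> star p a b"
    and infinite_support: "infinite (msupport S)"
    and rotation_invariant: "distr S borel (\<lambda>z. cis (2 * pi / real (p + 1)) * z) = S"
begin

lemma AE_star_coord: "AE t in S. star_coord p t \<in> {a..b} \<and> of_real (star_coord p t) = t ^ (p + 1)"
  using AE_in_star by eventually_elim (rule star_coord_star)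

text \<open>Only finitely many points of the star lie over a given point of the interval, so the image of a
measure with infinite support has infinite support.\<close>

lemma interval_measure_star_coord: "interval_measure (distr S borel (star_coord p)) a b"
proof -
  interpret D: finite_measure "distr S borel (star_coord p)" by (rule finite_measure_distr) measurable
  show ?thesis
  proof
    show "AE x in distr S borel (star_coord p). x \<in> {a..b}"
      using AE_star_coord by (subst AE_distr_iff) auto
    show "\<not> (AE x in distr S borel (star_coord p). x \<in> F)" if F: "finite F" for F
    proof
      assume "AE x in distr S borel (star_coord p). x \<in> F"
      then have "AE t in S. star_coord p t \<in> F"
        using F by (subst (asm) AE_distr_iff) (auto intro: borel_closed finite_imp_closed)
      define R where "R = {t. t ^ (p + 1) \<in> complex_of_real ` F}"
      have "R = (\<Union>x\<in>F. {t. t ^ (p + 1) = of_real x})" by (auto simp: R_def)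
      then have R: "finite R" using F finite_nth_roots[of "p + 1"] by simp
      then have "closed R" by (rule finite_imp_closed)
      have "AE t in S. t \<in> R"
        using \<open>AE t in S. star_coord p t \<in> F\<close> AE_star_coord
      proof eventually_elim
        case (elim t)
        then show ?case unfolding R_def mem_Collect_eq by (metis imageI)
      qed
      then have "AE t in S. \<not> t \<in> - R" by simp
      moreover have "space S = UNIV" using sets_eq_imp_space_eq[OF sets_S] by simp
      ultimately have "emeasure S (- R) = 0"
        using \<open>closed R\<close> sets_S by (subst (asm) AE_iff_measurable[where N = "- R"]) auto
      then have "msupport S \<subseteq> R"
        using \<open>closed R\<close> unfolding msupport_def by (force simp: open_Compl)
      then show False using infinite_support R finite_subset by blast
    qed
  qed (use a_less_b in auto)
qed

lemma integral_rotate: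
  fixes f :: "complex \<Rightarrow> complex"
  assumes [measurable]: "f \<in> borel_measurable borel"
  shows "(\<integral>t. f (cis (2 * pi / real (p + 1)) * t) \<partial>S) = (\<integral>t. f t \<partial>S)"
proof -
  have "(\<integral>t. f t \<partial>S) = (\<integral>t. f t \<partial>distr S borel (\<lambda>z. cis (2 * pi / real (p + 1)) * z))"
    by (simp only: rotation_invariant)
  also have "\<dots> = (\<integral>t. f (cis (2 * pi / real (p + 1)) * t) \<partial>S)"
    by (rule integral_distr) measurable
  finally show ?thesis by simp
qed

lemma rotation_power_eq_1_iff: "cis (2 * pi / real (p + 1)) ^ e = 1 \<longleftrightarrow> (p + 1) dvd e"
proof -
  have "cis (2 * pi / real (p + 1)) ^ e = exp (2 * of_real pi * \<i> * of_nat e / of_nat (p + 1))"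
    unfolding Complex.DeMoivre unfolding cis_conv_exp
    by (rule arg_cong[where f = exp]) (simp add: field_simps del: of_nat_Suc of_nat_add)
  then show ?thesis using complex_root_unity_eq_1[of "p + 1" e] by simp
qed

text \<open>A rotation multiplies the integrand by a root of unity, which is \<open>1\<close> only if \<open>p + 1\<close> divides \<open>e\<close>.\<close>

lemma integral_power_times_star_coord:
  fixes F :: "real \<Rightarrow> complex"
  assumes [measurable]: "F \<in> borel_measurable borel"
  shows "(\<integral>t. t ^ e * F (star_coord p t) \<partial>S) =
    (if (p + 1) dvd e then \<integral>x. of_real x ^ (e div (p + 1)) * F x \<partial>distr S borel (star_coord p) else 0)"
proof (cases "(p + 1) dvd e")
  case True
  then obtain s where s: "e = (p + 1) * s" by (rule dvdE)
  have "(\<integral>x. of_real x ^ s * F x \<partial>distr S borel (star_coord p)) = (\<integral>t. of_real (star_coord p t) ^ s * F (star_coord p t) \<partial>S)"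
    by (rule integral_distr) measurable
  also have "\<dots> = (\<integral>t. t ^ e * F (star_coord p t) \<partial>S)"
  proof (rule integral_cong_AE)
    show "AE t in S. of_real (star_coord p t) ^ s * F (star_coord p t) = t ^ e * F (star_coord p t)"
      using AE_star_coord by eventually_elim (simp only: s power_mult)
  qed measurable
  finally have "(\<integral>x. of_real x ^ s * F x \<partial>distr S borel (star_coord p)) = (\<integral>t. t ^ e * F (star_coord p t) \<partial>S)" .
  moreover have "e div (p + 1) = s" unfolding s by (rule nonzero_mult_div_cancel_left) simp
  ultimately show ?thesis using True by simp
next
  case False
  define w where "w = cis (2 * pi / real (p + 1))"
  have w: "w ^ (p + 1) = 1" "w ^ e \<noteq> 1"
    using rotation_power_eq_1_iff[of "p + 1"] rotation_power_eq_1_iff[of e] False by (auto simp: w_def)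
  have tr: "star_coord p (w * t) = star_coord p t" for t
    using w(1) by (simp only: star_coord_def power_mult_distrib mult_1_left)
  have "(\<integral>t. t ^ e * F (star_coord p t) \<partial>S) = (\<integral>t. (w * t) ^ e * F (star_coord p (w * t)) \<partial>S)"
    unfolding w_def by (rule integral_rotate[symmetric]) measurable
  also have "\<dots> = (\<integral>t. w ^ e * (t ^ e * F (star_coord p t)) \<partial>S)"
    unfolding tr by (simp add: power_mult_distrib ac_simps)
  also have "\<dots> = w ^ e * (\<integral>t. t ^ e * F (star_coord p t) \<partial>S)" by simp
  finally show ?thesis using w(2) False by simp
qed

lemma integrable_power_times_star_coord:
  fixes F :: "real \<Rightarrow> complex"
  assumes [measurable]: "F \<in> borel_measurable borel" and Fc: "continuous_on {a..b} F"
  shows "integrable S (\<lambda>t. t ^ e * F (star_coord p t))"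
proof -
  have "continuous_on (star p a b) (star_coord p)" unfolding star_coord_def by (intro continuous_intros)
  then have "compact ((\<lambda>t. t ^ e * F (star_coord p t)) ` star p a b)"
    using star_coord_star
    by (intro compact_continuous_image continuous_intros compact_star continuous_on_compose2[OF Fc]) auto
  from compact_imp_bounded[OF this]
  obtain B where B: "\<And>t. t \<in> star p a b \<Longrightarrow> norm (t ^ e * F (star_coord p t)) \<le> B"
    unfolding bounded_iff by blast
  have "AE t in S. norm (t ^ e * F (star_coord p t)) \<le> B"
    using AE_in_star by eventually_elim (rule B)
  then show ?thesis by (intro integrable_const_bound) auto
qed

text \<open>Expand \<open>1 / (z - t)\<close> as \<open>(\<Sum>m\<le>p. z\<^sup>p\<^sup>-\<^sup>m t\<^sup>m) / (z\<^sup>p\<^sup>+\<^sup>1 - t\<^sup>p\<^sup>+\<^sup>1)\<close>. Integration over the invariant measure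
leaves only the term whose total power of \<open>t\<close> is a multiple of \<open>p + 1\<close>.\<close>

lemma cauchy_transform_star_coord:
  assumes g [measurable]: "g \<in> borel_measurable borel" and gc: "continuous_on {a..b} g"
    and z: "z ^ (p + 1) = of_real x" "x \<notin> {a..b}" and i: "i \<le> p" "(p + 1) dvd (e + i)"
  shows "(\<integral>t. t ^ e * of_real (g (star_coord p t)) / (z - t) \<partial>S) =
    z ^ (p - i) * of_real (\<integral>u. u ^ ((e + i) div (p + 1)) * g u / (x - u) \<partial>distr S borel (star_coord p))"
proof -
  define F where "F = (\<lambda>u. complex_of_real (g u / (x - u)))"
  have [measurable]: "F \<in> borel_measurable borel" unfolding F_def by measurable
  have Fc: "continuous_on {a..b} F" unfolding F_def using z(2) by (auto intro!: continuous_intros gc)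
  have "(\<integral>t. t ^ e * of_real (g (star_coord p t)) / (z - t) \<partial>S) =
      (\<integral>t. (\<Sum>m<p+1. z ^ (p - m) * (t ^ (e + m) * F (star_coord p t))) \<partial>S)"
  proof (rule integral_cong_AE)
    show "AE t in S. t ^ e * of_real (g (star_coord p t)) / (z - t) =
        (\<Sum>m<p+1. z ^ (p - m) * (t ^ (e + m) * F (star_coord p t)))"
      using AE_star_coord
    proof eventually_elim
      case (elim t)
      define D where "D = z ^ (p + 1) - t ^ (p + 1)"
      have D: "D = of_real (x - star_coord p t)" using elim z(1) by (simp add: D_def)
      have "x \<noteq> star_coord p t" using elim z(2) by auto
      then have Dnz: "D \<noteq> 0" unfolding D of_real_eq_0_iff by simp
      have "D = - ((t - z) * (\<Sum>m<p+1. z ^ (p + 1 - Suc m) * t ^ m))"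
        unfolding D_def using power_diff_sumr2[of t "p + 1" z] by (metis minus_diff_eq)
      then have fac: "D = (z - t) * (\<Sum>m<p+1. z ^ (p - m) * t ^ m)" by (simp add: algebra_simps)
      then have zt: "z - t \<noteq> 0" using Dnz by auto
      have "(\<Sum>m<p+1. z ^ (p - m) * (t ^ (e + m) * F (star_coord p t))) =
          t ^ e * (of_real (g (star_coord p t)) / D) * (\<Sum>m<p+1. z ^ (p - m) * t ^ m)"
        unfolding sum_distrib_left by (intro sum.cong) (auto simp: power_add F_def D)
      also have "t ^ e * (of_real (g (star_coord p t)) / D) * (\<Sum>m<p+1. z ^ (p - m) * t ^ m) =
          t ^ e * of_real (g (star_coord p t)) * ((\<Sum>m<p+1. z ^ (p - m) * t ^ m) / D)" by simp
      also have "(\<Sum>m<p+1. z ^ (p - m) * t ^ m) / D = 1 / (z - t)"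
        using zt Dnz unfolding fac by (simp del: sum.lessThan_Suc)
      finally show ?case by (simp only: times_divide_eq_right mult_1_right)
    qed
  qed measurable
  also have "\<dots> = (\<Sum>m<p+1. z ^ (p - m) * (\<integral>t. t ^ (e + m) * F (star_coord p t) \<partial>S))"
    using integrable_power_times_star_coord[OF _ Fc] by (subst Bochner_Integration.integral_sum) auto
  also have "\<dots> = (\<Sum>m<p+1. if m = i then z ^ (p - i) * (\<integral>t. t ^ (e + i) * F (star_coord p t) \<partial>S) else 0)"
  proof (rule sum.cong)
    fix m assume "m \<in> {..<p + 1}"
    have "m = i" if "(p + 1) dvd (e + m)"
    proof -
      have "(p + 1) dvd (m - i)" "(p + 1) dvd (i - m)"
        using dvd_diff_nat[OF that i(2)] dvd_diff_nat[OF i(2) that] by simp_all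
      then show ?thesis
        using \<open>m \<in> {..<p + 1}\<close> i(1)
        by (cases m i rule: linorder_cases) (force dest: dvd_imp_le)+
    qed
    then have "(\<integral>t. t ^ (e + m) * F (star_coord p t) \<partial>S) = 0" if "m \<noteq> i"
      using that integral_power_times_star_coord[of F "e + m"] by auto
    then show "z ^ (p - m) * (\<integral>t. t ^ (e + m) * F (star_coord p t) \<partial>S) =
        (if m = i then z ^ (p - i) * (\<integral>t. t ^ (e + i) * F (star_coord p t) \<partial>S) else 0)"
      by (cases "m = i") simp_all
  qed simp
  also have "\<dots> = z ^ (p - i) * (\<integral>t. t ^ (e + i) * F (star_coord p t) \<partial>S)"
    using i(1) by (simp del: sum.lessThan_Suc)
  also have "(\<integral>t. t ^ (e + i) * F (star_coord p t) \<partial>S) =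
     (\<integral>u. of_real (u ^ ((e + i) div (p + 1)) * g u / (x - u)) \<partial>distr S borel (star_coord p))"
    using i(2) by (subst integral_power_times_star_coord) (auto simp: F_def)
  also have "\<dots> = of_real (\<integral>u. u ^ ((e + i) div (p + 1)) * g u / (x - u) \<partial>distr S borel (star_coord p))"
    by (rule integral_complex_of_real)
  finally show ?thesis .
qed

end

section \<open>Nikishin systems on a star\<close>

lemma le_int_div_iff:
  assumes p: "0 < p"
  shows "int l \<le> (int n - int j - 1) div int p \<longleftrightarrow> p * l + j + 1 \<le> n"
proof -
  have "int l \<le> (int n - int j - 1) div int p \<longleftrightarrow> int l * int p \<le> int n - int j - 1"
  proof
    assume "int l \<le> (int n - int j - 1) div int p"
    then have "int l * int p \<le> (int n - int j - 1) div int p * int p" using p by (intro mult_right_mono) auto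
    also have "\<dots> \<le> int n - int j - 1" using p
      by (metis add_le_cancel_left add.right_neutral div_mult_mod_eq of_nat_0_less_iff pos_mod_sign)
    finally show "int l * int p \<le> int n - int j - 1" .
  next
    assume "int l * int p \<le> int n - int j - 1"
    then have "int l * int p div int p \<le> (int n - int j - 1) div int p" using p by (intro zdiv_mono1) auto
    then show "int l \<le> (int n - int j - 1) div int p" using p by simp
  qed
  also have "\<dots> \<longleftrightarrow> int (p * l + j + 1) \<le> int n" by (simp add: algebra_simps)
  finally show ?thesis by (simp only: of_nat_le_iff)
qed

lemma sum_over_residue_class:
  fixes f :: "nat \<Rightarrow> 'a::comm_monoid_add"
  assumes "\<And>i. i \<le> r + N * e0 \<Longrightarrow> f i \<noteq> 0 \<Longrightarrow> \<exists>e. i = r + N * e" and "0 < N"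
  shows "(\<Sum>i\<le>r + N * e0. f i) = (\<Sum>e\<le>e0. f (r + N * e))"
proof -
  have inj: "inj_on (\<lambda>e. r + N * e) {..e0}" using assms(2) by (auto simp: inj_on_def)
  have "(\<Sum>i\<le>r + N * e0. f i) = (\<Sum>i\<in>(\<lambda>e. r + N * e) ` {..e0}. f i)"
  proof (rule sum.mono_neutral_right)
    show "\<forall>i\<in>{..r + N * e0} - (\<lambda>e. r + N * e) ` {..e0}. f i = 0"
    proof
      fix i assume i: "i \<in> {..r + N * e0} - (\<lambda>e. r + N * e) ` {..e0}"
      show "f i = 0"
      proof (rule ccontr)
        assume "f i \<noteq> 0"
        then obtain e where e: "i = r + N * e" using assms(1)[of i] i by auto
        then have "e \<le> e0" using i assms(2) by auto
        then show False using i e by auto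
      qed
    qed
  qed auto
  also have "\<dots> = (\<Sum>e\<le>e0. f (r + N * e))" using inj by (subst sum.reindex) auto
  finally show ?thesis .
qed

locale star_nikishin =
  fixes p :: nat and a b :: "nat \<Rightarrow> real" and \<sigma> :: "nat \<Rightarrow> complex measure"
  assumes p_ge_1: "1 \<le> p" and generators: "nikishin_generators p a b \<sigma>"
begin

text \<open>The image of \<open>\<sigma>\<^sub>k\<close> under \<open>z \<mapsto> z\<^sup>p\<^sup>+\<^sup>1\<close>.\<close>

definition \<nu> :: "nat \<Rightarrow> real measure" where
  "\<nu> k = distr (\<sigma> k) borel (star_coord p)"

lemma invariant_star_measure:
  assumes k: "k < p"
  shows "invariant_star_measure (\<sigma> k) p (a k) (b k)"
proof -
  have sm: "star_measure p (a k) (b k) (\<sigma> k)" and ab: "a k < b k"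
    using generators k by (auto simp: nikishin_generators_def)
  have sets: "sets (\<sigma> k) = sets borel" using sm by (simp add: star_measure_def)
  have "- star p (a k) (b k) \<in> null_sets (\<sigma> k)"
    using sm closed_star[of p "a k" "b k"] by (auto simp: star_measure_def null_sets_def)
  then have "AE t in \<sigma> k. t \<in> star p (a k) (b k)" by (rule AE_I') auto
  then show ?thesis
    using sm ab by (intro invariant_star_measure.intro invariant_star_measure_axioms.intro) (auto simp: star_measure_def)
qed

lemma real_nikishin: "real_nikishin p a b \<nu>"
proof (rule real_nikishin.intro)
  show "1 \<le> p" by (rule p_ge_1)
  show "interval_measure (\<nu> k) (a k) (b k)" if "k < p" for k
    unfolding \<nu>_def using invariant_star_measure[OF that] by (rule invariant_star_measure.interval_measure_star_coord)
  show "0 \<notin> {a k<..<b k}" if "k < p" for k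
    using generators that by (cases "even k") (auto simp: nikishin_generators_def not_less)
  show "{a k..b k} \<inter> {a (Suc k)..b (Suc k)} = {}" if "Suc k < p" for k
  proof (rule ccontr)
    assume "{a k..b k} \<inter> {a (Suc k)..b (Suc k)} \<noteq> {}"
    then obtain x where x: "x \<in> {a k..b k}" "x \<in> {a (Suc k)..b (Suc k)}" by blast
    obtain z :: complex where z: "of_real x = z ^ (p + 1)" using exists_complex_root[of "p + 1" "of_real x"] by auto
    have "z \<in> star p (a k) (b k) \<inter> star p (a (Suc k)) (b (Suc k))"
      unfolding star_def z[symmetric] Int_iff mem_Collect_eq using x by blast
    moreover have "star p (a k) (b k) \<inter> star p (a (Suc k)) (b (Suc k)) = {}"
      using generators that by (simp add: nikishin_generators_def)
    ultimately show False by blast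
  qed
qed

sublocale real_nikishin p a b \<nu> by (rule real_nikishin)

lemma cauchy_measurable:
  assumes k: "k < p" and [measurable]: "G \<in> borel_measurable borel"
  shows "(\<lambda>z. \<integral>t. G t / (z - t) \<partial>\<sigma> k) \<in> borel_measurable borel"
proof -
  interpret invariant_star_measure "\<sigma> k" p "a k" "b k" using k by (rule invariant_star_measure)
  show ?thesis by (rule borel_measurable_lebesgue_integral) measurable
qed

lemma nikishin_cauchy_measurable:
  "k + i < p \<Longrightarrow> (\<lambda>z. nikishin_int \<sigma> k (k + i) (\<lambda>t. 1 / (z - t))) \<in> borel_measurable borel"
proof (induction i arbitrary: k)
  case 0
  then show ?case using cauchy_measurable[of k "\<lambda>_. 1"] by (simp add: nikishin_int.simps[of \<sigma> k k])
next
  case (Suc i)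
  have "(\<lambda>z. nikishin_int \<sigma> (Suc k) (Suc k + i) (\<lambda>t. 1 / (z - t))) \<in> borel_measurable borel"
    using Suc by (intro Suc.IH) simp
  then show ?case using cauchy_measurable[of k "\<lambda>z. nikishin_int \<sigma> (Suc k) (Suc k + i) (\<lambda>t. 1 / (z - t))"] Suc.prems
    by (subst nikishin_int.simps) simp
qed

definition cauchy_weight :: "nat \<Rightarrow> nat \<Rightarrow> real \<Rightarrow> real" where
  "cauchy_weight i k x = (\<integral>u. weight i k u / (x - u) \<partial>\<nu> k)"

lemma weight_Suc: "weight (Suc i) k t = t * cauchy_weight i (Suc k) t"
  by (simp add: cauchy_weight_def)

lemma cauchy_weight_measurable:
  "k + i < p \<Longrightarrow> cauchy_weight i k \<in> borel_measurable borel"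
  unfolding cauchy_weight_def
  by (rule interval_measure.borel_measurable_cauchy_transform[OF interval_measure])
    (auto intro: weight_measurable)

lemma cauchy_weight_continuous:
  "Suc k + i < p \<Longrightarrow> continuous_on {a k..b k} (cauchy_weight i (Suc k))"
  unfolding cauchy_weight_def
  by (rule interval_measure.continuous_on_cauchy_transform[OF interval_measure])
    (use weight_measurable weight_continuous disjoint_intervals[of k] in auto)

lemma AE_star:
  assumes "k < p"
  shows "AE t in \<sigma> k. star_coord p t \<in> {a k..b k} \<and> t ^ (p + 1) = of_real (star_coord p t)"
  using invariant_star_measure.AE_star_coord[OF invariant_star_measure[OF assms]] by eventually_elim simp

text \<open>The Cauchy transform of \<open>s\<^sub>k\<^sub>,\<^sub>k\<^sub>+\<^sub>i\<close> picks up one rotation factor per level, which shows in the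
exponent of \<open>z\<close>.\<close>

lemma nikishin_cauchy:
  "k + i < p \<Longrightarrow> z ^ (p + 1) = of_real x \<Longrightarrow> x \<notin> {a k..b k} \<Longrightarrow>
    nikishin_int \<sigma> k (k + i) (\<lambda>t. 1 / (z - t)) = z ^ (p - i) * of_real (cauchy_weight i k x)"
proof (induction i arbitrary: k z x)
  case 0
  interpret invariant_star_measure "\<sigma> k" p "a k" "b k" using 0 by (intro invariant_star_measure) simp
  show ?case using cauchy_transform_star_coord[of "\<lambda>_. 1" z x 0 0] 0
    by (simp add: nikishin_int.simps[of \<sigma> k k] cauchy_weight_def \<nu>_def)
next
  case (Suc i)
  have k: "k < p" "Suc k < p" using Suc.prems(1) by auto
  interpret invariant_star_measure "\<sigma> k" p "a k" "b k" using k by (intro invariant_star_measure)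
  have [measurable]: "(\<lambda>z. nikishin_int \<sigma> (Suc k) (Suc k + i) (\<lambda>t. 1 / (z - t))) \<in> borel_measurable borel"
      "cauchy_weight i (Suc k) \<in> borel_measurable borel"
    using nikishin_cauchy_measurable[of "Suc k" i] cauchy_weight_measurable[of "Suc k" i] Suc.prems by auto
  have "nikishin_int \<sigma> k (k + Suc i) (\<lambda>t. 1 / (z - t)) =
      (\<integral>t. nikishin_int \<sigma> (Suc k) (Suc k + i) (\<lambda>u. 1 / (t - u)) / (z - t) \<partial>\<sigma> k)"
    by (subst nikishin_int.simps) simp
  also have "\<dots> = (\<integral>t. t ^ (p - i) * of_real (cauchy_weight i (Suc k) (star_coord p t)) / (z - t) \<partial>\<sigma> k)"
  proof (rule integral_cong_AE)
    show "AE t in \<sigma> k. nikishin_int \<sigma> (Suc k) (Suc k + i) (\<lambda>u. 1 / (t - u)) / (z - t) =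
        t ^ (p - i) * of_real (cauchy_weight i (Suc k) (star_coord p t)) / (z - t)"
      using AE_star[OF k(1)]
    proof eventually_elim
      case (elim t)
      then have "star_coord p t \<notin> {a (Suc k)..b (Suc k)}" using disjoint_intervals[OF k(2)] by blast
      then show ?case using Suc.IH[of "Suc k" t "star_coord p t"] elim Suc.prems(1) by simp
    qed
  qed measurable
  also have "\<dots> = z ^ (p - Suc i) * of_real (\<integral>u. u ^ ((p - i + Suc i) div (p + 1)) *
      cauchy_weight i (Suc k) u / (x - u) \<partial>distr (\<sigma> k) borel (star_coord p))"
    using Suc.prems by (intro cauchy_transform_star_coord cauchy_weight_continuous) auto
  also have "(p - i + Suc i) div (p + 1) = 1" using Suc.prems(1) by simp
  finally show ?case unfolding cauchy_weight_def[of "Suc i"] weight_Suc \<nu>_def by simp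
qed

section \<open>The multiple orthogonal polynomials\<close>

definition moment :: "nat \<Rightarrow> nat \<Rightarrow> real" where
  "moment s j = (\<integral>u. u ^ s * weight j 0 u \<partial>\<nu> 0)"

text \<open>The integral of \<open>z\<^sup>i\<close> with respect to \<open>s\<^sub>0\<^sub>,\<^sub>j\<close>. Thus multiple orthogonality becomes a
linear system for the coefficients.\<close>

definition star_moment :: "nat \<Rightarrow> nat \<Rightarrow> real" where
  "star_moment j i = (if j \<le> i \<and> (p + 1) dvd (i - j) then moment ((i - j) div (p + 1)) j else 0)"

lemma star_moment_shift: "star_moment j (j + (p + 1) * s) = moment s j"
proof -
  have "j + (p + 1) * s - j = (p + 1) * s" by simp
  moreover have "(p + 1) * s div (p + 1) = s" by (rule nonzero_mult_div_cancel_left) simp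
  ultimately show ?thesis unfolding star_moment_def by (simp only: le_add1 dvd_triv_left simp_thms if_True)
qed

lemma nikishin_int_power:
  assumes j: "j < p"
  shows "integrable (\<sigma> 0) (\<lambda>z. z ^ i * (if j = 0 then 1 else nikishin_int \<sigma> 1 j (\<lambda>t. 1 / (z - t))))"
    and "nikishin_int \<sigma> 0 j (\<lambda>z. z ^ i) = of_real (star_moment j i)"
proof -
  have p0: "0 < p" using p_ge_1 by simp
  interpret invariant_star_measure "\<sigma> 0" p "a 0" "b 0" using p0 by (intro invariant_star_measure)
  let ?I = "integrable (\<sigma> 0) (\<lambda>z. z ^ i * (if j = 0 then 1 else nikishin_int \<sigma> 1 j (\<lambda>t. 1 / (z - t))))"
  have "?I \<and> nikishin_int \<sigma> 0 j (\<lambda>z. z ^ i) = of_real (star_moment j i)"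
  proof (cases j)
    case 0
    have int: "integrable (\<sigma> 0) (\<lambda>t. t ^ i * (\<lambda>_. 1) (star_coord p t))"
      by (intro integrable_power_times_star_coord) auto
    have "nikishin_int \<sigma> 0 0 (\<lambda>z. z ^ i) = (\<integral>t. t ^ i * (\<lambda>_. 1) (star_coord p t) \<partial>\<sigma> 0)"
      by (subst nikishin_int.simps) simp
    also have "\<dots> = (if (p + 1) dvd i then \<integral>x. of_real (x ^ (i div (p + 1))) \<partial>\<nu> 0 else 0)"
      unfolding \<nu>_def by (subst integral_power_times_star_coord) auto
    also have "\<dots> = of_real (star_moment 0 i)"
      unfolding star_moment_def moment_def by (auto simp: integral_complex_of_real simp del: of_real_power)
    finally show ?thesis using 0 int by simp
  next
    case (Suc j')
    have [measurable]: "cauchy_weight j' 1 \<in> borel_measurable borel"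
      "(\<lambda>z. nikishin_int \<sigma> 1 j (\<lambda>t. 1 / (z - t))) \<in> borel_measurable borel"
      using cauchy_weight_measurable[of 1 j'] nikishin_cauchy_measurable[of 1 j'] j Suc by auto
    define F where "F = (\<lambda>x. complex_of_real (cauchy_weight j' 1 x))"
    have [measurable]: "F \<in> borel_measurable borel" unfolding F_def by measurable
    have Fc: "continuous_on {a 0..b 0} F"
      unfolding F_def using cauchy_weight_continuous[of 0 j'] j Suc by (intro continuous_intros) auto
    have AE: "AE z in \<sigma> 0. z ^ i * nikishin_int \<sigma> 1 j (\<lambda>t. 1 / (z - t)) =
        z ^ (i + (p - j')) * F (star_coord p z)"
      using AE_star[OF p0]
    proof eventually_elim
      case (elim z)
      then have "star_coord p z \<notin> {a 1..b 1}" using disjoint_intervals[of 0] j Suc by auto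
      then show ?case
        unfolding F_def power_add
        using nikishin_cauchy[of 1 j' z "star_coord p z"] elim j Suc by simp
    qed
    have int: "integrable (\<sigma> 0) (\<lambda>z. z ^ (i + (p - j')) * F (star_coord p z))"
      using Fc by (intro integrable_power_times_star_coord) auto
    have "integrable (\<sigma> 0) (\<lambda>z. z ^ i * nikishin_int \<sigma> 1 j (\<lambda>t. 1 / (z - t)))"
    proof (rule integrable_cong_AE_imp[OF int])
      show "AE z in \<sigma> 0. z ^ (i + (p - j')) * F (star_coord p z) =
          z ^ i * nikishin_int \<sigma> 1 j (\<lambda>t. 1 / (z - t))"
        using AE by eventually_elim (rule sym)
    qed measurable
    then have ?I using Suc by simp
    have "nikishin_int \<sigma> 0 j (\<lambda>z. z ^ i) = (\<integral>z. z ^ i * nikishin_int \<sigma> 1 j (\<lambda>t. 1 / (z - t)) \<partial>\<sigma> 0)"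
      using Suc by (subst nikishin_int.simps) simp
    also have "\<dots> = (\<integral>z. z ^ (i + (p - j')) * F (star_coord p z) \<partial>\<sigma> 0)"
      using AE by (intro integral_cong_AE) measurable
    also have "\<dots> = (if (p + 1) dvd (i + (p - j'))
        then \<integral>x. of_real x ^ ((i + (p - j')) div (p + 1)) * F x \<partial>\<nu> 0 else 0)"
      unfolding \<nu>_def by (rule integral_power_times_star_coord) measurable
    also have "\<dots> = of_real (star_moment j i)"
    proof (cases "j \<le> i \<and> (p + 1) dvd (i - j)")
      case True
      then obtain s where s: "i - j = (p + 1) * s" by (meson dvdE)
      have "i + (p - j') = (i - j) + (p + 1)" using True j Suc by simp
      then have i: "i + (p - j') = (p + 1) * Suc s" unfolding s by simp
      have "(p + 1) dvd (i + (p - j'))" "(i + (p - j')) div (p + 1) = Suc s" "(i - j) div (p + 1) = s"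
        unfolding i s by (rule dvd_triv_left) (rule nonzero_mult_div_cancel_left, simp)+
      moreover have "(\<integral>x. of_real x ^ Suc s * F x \<partial>\<nu> 0) = of_real (moment s j)"
        unfolding moment_def integral_complex_of_real[symmetric] F_def Suc weight_Suc
        by (simp add: ac_simps)
      ultimately show ?thesis using True by (simp add: star_moment_def)
    next
      case False
      have "\<not> (p + 1) dvd (i + (p - j'))"
      proof
        assume dvd: "(p + 1) dvd (i + (p - j'))"
        then have "p + 1 \<le> i + (p - j')" using j Suc by (intro dvd_imp_le) auto
        then have "j \<le> i" using j Suc by simp
        moreover have "i + (p - j') = (i - j) + (p + 1)" using \<open>j \<le> i\<close> j Suc by simp
        then have "(p + 1) dvd (i - j)" using dvd by (metis dvd_add_triv_right_iff)
        ultimately show False using False by simp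
      qed
      then show ?thesis using False by (auto simp: star_moment_def)
    qed
    finally show ?thesis using \<open>?I\<close> by simp
  qed
  then show ?I "nikishin_int \<sigma> 0 j (\<lambda>z. z ^ i) = of_real (star_moment j i)" by auto
qed

lemma nikishin_int_poly:
  assumes j: "j < p" and B: "degree Q \<le> B"
  shows "nikishin_int \<sigma> 0 j (\<lambda>z. poly Q z * z ^ l) = (\<Sum>i\<le>B. coeff Q i * of_real (star_moment j (i + l)))"
proof -
  let ?w = "\<lambda>z. if j = 0 then 1 else nikishin_int \<sigma> 1 j (\<lambda>t. 1 / (z - t))"
  have w: "nikishin_int \<sigma> 0 j f = (\<integral>z. f z * ?w z \<partial>\<sigma> 0)" for f
    by (subst nikishin_int.simps) simp
  have "poly Q z * z ^ l * ?w z = (\<Sum>i\<le>B. coeff Q i * (z ^ (i + l) * ?w z))" for z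
  proof -
    have "poly Q z = (\<Sum>i\<le>B. coeff Q i * z ^ i)"
      unfolding poly_altdef using B by (intro sum.mono_neutral_left) (auto intro: coeff_eq_0)
    then show ?thesis by (simp add: sum_distrib_left sum_distrib_right power_add ac_simps)
  qed
  then have "nikishin_int \<sigma> 0 j (\<lambda>z. poly Q z * z ^ l) = (\<integral>z. (\<Sum>i\<le>B. coeff Q i * (z ^ (i + l) * ?w z)) \<partial>\<sigma> 0)"
    unfolding w by simp
  also have "\<dots> = (\<Sum>i\<le>B. coeff Q i * (\<integral>z. z ^ (i + l) * ?w z \<partial>\<sigma> 0))"
    using nikishin_int_power(1)[OF j] by (subst Bochner_Integration.integral_sum) auto
  also have "\<dots> = (\<Sum>i\<le>B. coeff Q i * of_real (star_moment j (i + l)))"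
    unfolding w[symmetric] nikishin_int_power(2)[OF j] ..
  finally show ?thesis .
qed

lemma multiple_orthogonal_iff:
  assumes "degree Q \<le> B"
  shows "multiple_orthogonal p \<sigma> n Q \<longleftrightarrow>
    (\<forall>j<p. \<forall>l. p * l + j + 1 \<le> n \<longrightarrow> (\<Sum>i\<le>B. coeff Q i * of_real (star_moment j (i + l))) = 0)"
  unfolding multiple_orthogonal_def using nikishin_int_poly[OF _ assms] le_int_div_iff p_ge_1 by auto

lemma multiple_orthogonal_linear:
  assumes "multiple_orthogonal p \<sigma> n Q" "multiple_orthogonal p \<sigma> n R"
  shows "multiple_orthogonal p \<sigma> n (smult c Q + smult d R)"
proof -
  define B where "B = max (degree Q) (degree R)"
  have B: "degree Q \<le> B" "degree R \<le> B" by (auto simp: B_def)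
  then have B': "degree (smult c Q + smult d R) \<le> B"
    by (intro degree_add_le order_trans[OF degree_smult_le])
  show ?thesis
    unfolding multiple_orthogonal_iff[OF B']
  proof (intro allI impI)
    fix j l assume j: "j < p" "p * l + j + 1 \<le> n"
    have "(\<Sum>i\<le>B. coeff (smult c Q + smult d R) i * of_real (star_moment j (i + l))) =
       c * (\<Sum>i\<le>B. coeff Q i * of_real (star_moment j (i + l))) +
       d * (\<Sum>i\<le>B. coeff R i * of_real (star_moment j (i + l)))"
      unfolding sum_distrib_left sum.distrib[symmetric] by (intro sum.cong) (auto simp: algebra_simps)
    also have "\<dots> = 0"
      using assms j unfolding multiple_orthogonal_iff[OF B(1)] multiple_orthogonal_iff[OF B(2)] by simp
    finally show "(\<Sum>i\<le>B. coeff (smult c Q + smult d R) i * of_real (star_moment j (i + l))) = 0" .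
  qed
qed

lemma orth_moments:
  assumes "degree q \<le> B"
  shows "(\<integral>t. poly q t * t ^ (m div p) * weight (m mod p) 0 t \<partial>\<nu> 0) =
    (\<Sum>e\<le>B. coeff q e * moment (e + m div p) (m mod p))"
proof -
  have "poly q t * t ^ (m div p) * weight (m mod p) 0 t =
      (\<Sum>e\<le>B. coeff q e * (poly (monom 1 e) t * t ^ (m div p) * weight (m mod p) 0 t))" for t
  proof -
    have "poly q t = (\<Sum>i\<le>B. coeff q i * t ^ i)"
      unfolding poly_altdef using assms by (intro sum.mono_neutral_left) (auto intro: coeff_eq_0)
    then show ?thesis by (simp add: sum_distrib_left sum_distrib_right poly_monom ac_simps)
  qed
  then have "(\<integral>t. poly q t * t ^ (m div p) * weight (m mod p) 0 t \<partial>\<nu> 0) =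
      (\<Sum>e\<le>B. coeff q e * (\<integral>t. poly (monom 1 e) t * t ^ (m div p) * weight (m mod p) 0 t \<partial>\<nu> 0))"
    using integrable_orth_term by simp
  then show ?thesis by (simp add: moment_def poly_monom power_add)
qed

text \<open>Keep only the coefficients of \<open>R\<close> in the residue class of its degree modulo \<open>p + 1\<close>, scaled to make
\<open>R\<close> monic, and take real parts. This gives a nonzero real polynomial \<open>q\<close> with at least
\<open>degree q + 1\<close> orthogonality conditions if \<open>degree R < n\<close>, against \<open>degree_lower_bound\<close>.\<close>

lemma degree_multiple_orthogonal:
  assumes mo: "multiple_orthogonal p \<sigma> n R" and R: "R \<noteq> 0"
  shows "n \<le> degree R"
proof (rule ccontr)
  assume less: "\<not> n \<le> degree R"
  define N where "N = p + 1"
  define r where "r = degree R mod N"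
  define e0 where "e0 = degree R div N"
  have N: "0 < N" by (simp add: N_def)
  have deg: "degree R = r + N * e0" unfolding r_def e0_def by (rule mod_mult_div_eq[symmetric])
  have rN: "r \<le> p" using mod_less_divisor[OF N, of "degree R"] by (simp add: r_def N_def)
  define R' where "R' = smult (1 / lead_coeff R) R"
  have mo': "multiple_orthogonal p \<sigma> n R'"
    using multiple_orthogonal_linear[OF mo mo, of "1 / lead_coeff R" 0] by (simp add: R'_def)
  have "degree R' = degree R" using R by (simp add: R'_def)
  then have degR': "degree R' = r + N * e0" unfolding deg .
  have "coeff R' (degree R) = 1" using R by (simp add: R'_def)
  then have lead: "coeff R' (r + N * e0) = 1" unfolding deg .
  define q where "q = (\<Sum>e\<le>e0. monom (Re (coeff R' (r + N * e))) e)"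
  have cq: "coeff q e = (if e \<le> e0 then Re (coeff R' (r + N * e)) else 0)" for e
    by (simp add: q_def coeff_sum coeff_monom)
  have degq: "degree q \<le> e0" by (rule degree_le) (simp add: cq)
  have "coeff q e0 = 1" using lead by (simp add: cq)
  then have qnz: "q \<noteq> 0" by auto
  have "orth r (e0 + 1) q"
    unfolding orth_def
  proof (intro allI impI)
    fix m assume m: "r \<le> m \<and> m < r + (e0 + 1)"
    define j where "j = m mod p"
    define s where "s = m div p"
    have ms: "m = j + p * s" and j: "j < p" using p_ge_1 by (auto simp: j_def s_def)
    have "r \<le> j + N * s"
    proof (cases "s = 0")
      case False
      then have "N * 1 \<le> N * s" by (intro mult_le_mono2) auto
      then show ?thesis using rN by (simp add: N_def)
    qed (use m ms in simp)
    then obtain l where l: "j + N * s = r + l" using le_Suc_ex by blast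
    have "p * l + j + 1 \<le> n"
    proof -
      have "p * (j + N * s) = p * r + p * l" unfolding l by (simp add: distrib_left)
      then have "p * r + p * l + j = N * m" unfolding ms N_def by (simp add: algebra_simps)
      moreover have "N * m \<le> N * (r + e0)" using m by (intro mult_le_mono2) simp
      moreover have "N * (r + e0) = p * r + (r + N * e0)" unfolding N_def by (simp add: algebra_simps)
      ultimately show ?thesis using less deg by linarith
    qed
    then have "(\<Sum>i\<le>r + N * e0. coeff R' i * of_real (star_moment j (i + l))) = 0"
      using mo' j unfolding multiple_orthogonal_iff[OF eq_refl[OF degR']] by blast
    moreover have "(\<Sum>i\<le>r + N * e0. coeff R' i * of_real (star_moment j (i + l))) =
        (\<Sum>e\<le>e0. coeff R' (r + N * e) * of_real (star_moment j (r + N * e + l)))"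
    proof (rule sum_over_residue_class)
      fix i assume "coeff R' i * complex_of_real (star_moment j (i + l)) \<noteq> 0"
      then have "j \<le> i + l" "N dvd (i + l - j)" by (auto simp: star_moment_def N_def split: if_splits)
      then obtain c where c: "i + l = j + N * c" by (metis dvdE le_add_diff_inverse)
      then have i: "i + N * s = r + N * c" using l by simp
      have "s \<le> c"
      proof (rule ccontr)
        assume "\<not> s \<le> c"
        then have "N * (c + 1) \<le> N * s" by (intro mult_le_mono2) simp
        then show False using i rN by (simp add: N_def)
      qed
      then obtain e where "c = s + e" using le_Suc_ex by blast
      then show "\<exists>e. i = r + N * e" using i by (intro exI[of _ e]) (simp add: distrib_left)
    qed (rule N)
    moreover have "star_moment j (r + N * e + l) = moment (e + s) j" for e
    proof -
      have "r + N * e + l = j + N * (e + s)" using l by (simp add: distrib_left)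
      then show ?thesis using star_moment_shift[of j "e + s"] by (simp only: N_def)
    qed
    ultimately have "Re (\<Sum>e\<le>e0. coeff R' (r + N * e) * of_real (moment (e + s) j)) = 0" by simp
    then show "(\<integral>t. poly q t * t ^ (m div p) * weight (m mod p) 0 t \<partial>\<nu> 0) = 0"
      unfolding orth_moments[OF degq, of m] unfolding j_def[symmetric] s_def[symmetric] by (simp add: cq)
  qed
  from degree_lower_bound[OF this rN qnz] degq show False by simp
qed

text \<open>The polynomial \<open>z\<^sup>l q(z\<^sup>p\<^sup>+\<^sup>1)\<close>.\<close>

definition star_lift :: "nat \<Rightarrow> real poly \<Rightarrow> complex poly" where
  "star_lift l q = (\<Sum>e\<le>degree q. monom (of_real (coeff q e)) (l + (p + 1) * e))"

lemma poly_star_lift: "poly (star_lift l q) z = z ^ l * poly (map_poly of_real q) (z ^ (p + 1))"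
proof -
  have deg: "degree (map_poly complex_of_real q) = degree q" by (rule degree_map_poly) simp
  have "poly (map_poly of_real q) (z ^ (p + 1)) = (\<Sum>e\<le>degree q. of_real (coeff q e) * (z ^ (p + 1)) ^ e)"
    unfolding poly_altdef deg by (intro sum.cong) (auto simp: coeff_map_poly)
  then show ?thesis
    unfolding star_lift_def poly_sum poly_monom
    by (simp only: sum_distrib_left power_add power_mult mult.left_commute)
qed

lemma sum_coeff_star_lift:
  fixes f :: "nat \<Rightarrow> complex"
  shows "(\<Sum>i\<le>l + (p + 1) * degree q. coeff (star_lift l q) i * f i) =
    (\<Sum>e\<le>degree q. of_real (coeff q e) * f (l + (p + 1) * e))"
proof -
  have "(\<Sum>i\<le>l + (p + 1) * degree q. coeff (star_lift l q) i * f i) =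
      (\<Sum>i\<le>l + (p + 1) * degree q. \<Sum>e\<le>degree q. if l + (p + 1) * e = i then of_real (coeff q e) * f i else 0)"
    unfolding star_lift_def coeff_sum coeff_monom sum_distrib_right by (intro sum.cong) auto
  also have "\<dots> = (\<Sum>e\<le>degree q. \<Sum>i\<le>l + (p + 1) * degree q. if l + (p + 1) * e = i then of_real (coeff q e) * f i else 0)"
    by (rule sum.swap)
  also have "\<dots> = (\<Sum>e\<le>degree q. of_real (coeff q e) * f (l + (p + 1) * e))"
  proof (rule sum.cong)
    fix e assume "e \<in> {..degree q}"
    then have "(p + 1) * e \<le> (p + 1) * degree q" by (intro mult_le_mono2) simp
    then show "(\<Sum>i\<le>l + (p + 1) * degree q. if l + (p + 1) * e = i then of_real (coeff q e) * f i else 0) =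
        of_real (coeff q e) * f (l + (p + 1) * e)"
      by (subst sum.delta') auto
  qed simp
  finally show ?thesis .
qed

lemma degree_star_lift:
  assumes "lead_coeff q = 1"
  shows "degree (star_lift l q) = l + (p + 1) * degree q" "lead_coeff (star_lift l q) = 1"
proof -
  have le: "degree (star_lift l q) \<le> l + (p + 1) * degree q"
    unfolding star_lift_def
  proof (intro degree_sum_le order_trans[OF degree_monom_le])
    fix e assume "e \<in> {..degree q}"
    then have "(p + 1) * e \<le> (p + 1) * degree q" by (intro mult_le_mono2) simp
    then show "l + (p + 1) * e \<le> l + (p + 1) * degree q" by simp
  qed simp
  have "coeff (star_lift l q) (l + (p + 1) * degree q) = (\<Sum>e\<le>degree q. if e = degree q then 1 else 0)"
    unfolding star_lift_def coeff_sum coeff_monom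
  proof (rule sum.cong)
    fix e
    have "l + (p + 1) * e = l + (p + 1) * degree q \<longleftrightarrow> e = degree q"
      by (simp only: add_left_cancel mult_cancel1) simp
    then show "(if l + (p + 1) * e = l + (p + 1) * degree q then complex_of_real (coeff q e) else 0) =
        (if e = degree q then 1 else 0)"
      using assms by simp
  qed simp
  then have 1: "coeff (star_lift l q) (l + (p + 1) * degree q) = 1" by simp
  then show deg: "degree (star_lift l q) = l + (p + 1) * degree q"
    using le le_degree[of "star_lift l q" "l + (p + 1) * degree q"] by simp
  show "lead_coeff (star_lift l q) = 1" unfolding deg by (rule 1)
qed

text \<open>The condition with indices \<open>j\<close> and \<open>i\<close> is void unless \<open>l + i - j\<close> is a multiple \<open>(p + 1) s\<close>, and then it
is the condition with number \<open>m = j + p s\<close> on \<open>q\<close>. The inequality for \<open>i\<close> translates into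
\<open>l \<le> m < l + degree q\<close>.\<close>

lemma multiple_orthogonal_star_lift:
  assumes q: "lead_coeff q = 1" "orth l (degree q) q" and l: "l \<le> p"
  shows "multiple_orthogonal p \<sigma> (l + (p + 1) * degree q) (star_lift l q)"
  unfolding multiple_orthogonal_iff[OF eq_refl[OF degree_star_lift(1)[OF q(1)]]]
proof (intro allI impI)
  fix j i assume j: "j < p" and i: "p * i + j + 1 \<le> l + (p + 1) * degree q"
  define N where "N = p + 1"
  have "(\<Sum>e\<le>degree q. coeff q e * star_moment j (l + N * e + i)) = 0"
  proof (cases "\<exists>s. l + i = j + N * s")
    case True
    then obtain s where s: "l + i = j + N * s" by blast
    define m where "m = j + p * s"
    have mdiv: "m div p = s" "m mod p = j" using j by (auto simp: m_def)
    have "star_moment j (l + N * e + i) = moment (e + s) j" for e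
    proof -
      have "l + N * e + i = j + N * (e + s)" using s by (simp add: distrib_left)
      then show ?thesis using star_moment_shift[of j "e + s"] by (simp only: N_def)
    qed
    moreover have "l \<le> m"
    proof (cases "s = 0")
      case False
      then have "p * 1 \<le> p * s" by (intro mult_le_mono2) auto
      then show ?thesis using l unfolding m_def by linarith
    qed (use s in \<open>simp add: m_def\<close>)
    moreover have "m < l + degree q"
    proof -
      have "p * l + p * i = p * j + p * (N * s)" using arg_cong[OF s, of "\<lambda>x. p * x"] by (simp add: distrib_left)
      then have "p * l + p * i + j = N * m" by (simp add: m_def N_def algebra_simps)
      moreover have "p * l + (l + N * degree q) = N * (l + degree q)" by (simp add: N_def algebra_simps)
      ultimately have "N * m < N * (l + degree q)" using i unfolding N_def[symmetric] by linarith
      then show ?thesis by simp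
    qed
    moreover have "(\<integral>t. poly q t * t ^ (m div p) * weight (m mod p) 0 t \<partial>\<nu> 0) = 0" if "l \<le> m" "m < l + degree q"
      using q(2) that unfolding orth_def by blast
    ultimately show ?thesis using orth_moments[of q "degree q" m] unfolding mdiv by simp
  next
    case False
    have "star_moment j (l + N * e + i) = 0" for e
    proof (rule ccontr)
      assume "star_moment j (l + N * e + i) \<noteq> 0"
      then have "j \<le> l + N * e + i" "N dvd (l + N * e + i - j)"
        by (auto simp: star_moment_def N_def split: if_splits)
      then obtain c where c: "l + N * e + i = j + N * c" by (metis dvdE le_add_diff_inverse)
      have "e \<le> c"
      proof (rule ccontr)
        assume "\<not> e \<le> c"
        then have "N * (c + 1) \<le> N * e" by (intro mult_le_mono2) simp
        then show False using c j by (simp add: N_def)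
      qed
      then obtain s where "c = e + s" using le_Suc_ex by blast
      then have "l + i = j + N * s" using c by (simp add: distrib_left)
      then show False using False by blast
    qed
    then show ?thesis by simp
  qed
  then have "(\<Sum>e\<le>degree q. complex_of_real (coeff q e) * of_real (star_moment j (l + N * e + i))) = 0"
    by (metis (mono_tags, lifting) of_real_0 of_real_mult of_real_sum sum.cong)
  then show "(\<Sum>e\<le>l + (p + 1) * degree q. coeff (star_lift l q) e * of_real (star_moment j (e + i))) = 0"
    unfolding sum_coeff_star_lift unfolding N_def .
qed

definition reduced_orthogonal :: "nat \<Rightarrow> real poly \<Rightarrow> bool" where
  "reduced_orthogonal n q \<longleftrightarrow>
     lead_coeff q = 1 \<and> degree q = n div (p + 1) \<and> orth (n mod (p + 1)) (n div (p + 1)) q"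

lemma reduced_orthogonal_exists: "\<exists>q. reduced_orthogonal n q"
proof -
  have "n mod (p + 1) \<le> p" by (simp add: less_Suc_eq_le[symmetric])
  then show ?thesis using orth_monic_exists unfolding reduced_orthogonal_def by blast
qed

text \<open>The difference of two monic solutions of minimal degree would be a solution of smaller degree.\<close>

lemma mop_eq:
  assumes q: "reduced_orthogonal n q"
  shows "mop p \<sigma> n = star_lift (n mod (p + 1)) q"
proof -
  define l where "l = n mod (p + 1)"
  define Q where "Q = star_lift l q"
  have n: "n = l + (p + 1) * degree q"
    using q mod_mult_div_eq[of n "p + 1"] by (simp only: l_def reduced_orthogonal_def)
  have lp: "l \<le> p" by (simp add: l_def less_Suc_eq_le[symmetric])
  have q1: "lead_coeff q = 1" "orth l (degree q) q" using q by (auto simp: l_def reduced_orthogonal_def)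
  have Q: "lead_coeff Q = 1" "degree Q = n" using degree_star_lift[OF q1(1)] n by (auto simp: Q_def)
  have mo: "multiple_orthogonal p \<sigma> n Q" unfolding Q_def using multiple_orthogonal_star_lift[OF q1 lp] n by simp
  have lower: "n \<le> degree R" if "lead_coeff R = 1" "multiple_orthogonal p \<sigma> n R" for R
    using degree_multiple_orthogonal[OF that(2)] that(1) by force
  let ?P = "\<lambda>R. lead_coeff R = 1 \<and> multiple_orthogonal p \<sigma> n R"
  have "mop p \<sigma> n = Q"
    unfolding mop_def
  proof (rule the_equality)
    show "is_arg_min degree ?P Q"
      unfolding is_arg_min_def using Q mo lower by (auto simp: not_less)
    fix R assume "is_arg_min degree ?P R"
    then have R: "lead_coeff R = 1" "multiple_orthogonal p \<sigma> n R" "\<not> degree Q < degree R"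
      unfolding is_arg_min_def using Q mo by auto
    then have degR: "degree R = n" using lower[of R] Q by simp
    show "R = Q"
    proof (rule ccontr)
      assume "R \<noteq> Q"
      then have nz: "R - Q \<noteq> 0" by simp
      have "multiple_orthogonal p \<sigma> n (R - Q)"
        using multiple_orthogonal_linear[OF R(2) mo, of 1 "-1"] by simp
      then have "n \<le> degree (R - Q)" using nz by (rule degree_multiple_orthogonal)
      moreover have "degree (R - Q) \<le> n" using degR Q by (intro degree_diff_le) auto
      ultimately have "degree (R - Q) = n" by simp
      then have "lead_coeff (R - Q) = lead_coeff R - lead_coeff Q" using degR Q(2) by (simp only: coeff_diff)
      then have "lead_coeff (R - Q) = 0" unfolding R(1) Q(1) by simp
      then show False using nz leading_coeff_0_iff by blast
    qed
  qed
  then show ?thesis by (simp add: Q_def l_def)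
qed

lemma reduced_mop_eq:
  assumes q: "reduced_orthogonal n q"
  shows "reduced_mop p \<sigma> n = map_poly of_real q"
  unfolding reduced_mop_def mop_eq[OF q]
proof (rule the_equality)
  have deg: "degree (map_poly complex_of_real q) = degree q" by (rule degree_map_poly) simp
  then show "lead_coeff (map_poly complex_of_real q) = 1 \<and> degree (map_poly complex_of_real q) = n div (p + 1) \<and>
      (\<forall>z. poly (star_lift (n mod (p + 1)) q) z = z ^ (n mod (p + 1)) * poly (map_poly of_real q) (z ^ (p + 1)))"
    using q poly_star_lift by (auto simp: reduced_orthogonal_def coeff_map_poly)
  fix r :: "complex poly"
  assume r: "lead_coeff r = 1 \<and> degree r = n div (p + 1) \<and>
      (\<forall>z. poly (star_lift (n mod (p + 1)) q) z = z ^ (n mod (p + 1)) * poly r (z ^ (p + 1)))"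
  have "poly r w = poly (map_poly of_real q) w" if w: "w \<noteq> 0" for w
  proof -
    obtain z where z: "w = z ^ (p + 1)" using exists_complex_root[of "p + 1" w] by auto
    then have "z \<noteq> 0" using w by auto
    moreover have "z ^ (n mod (p + 1)) * poly r w = z ^ (n mod (p + 1)) * poly (map_poly of_real q) w"
      using r poly_star_lift unfolding z by metis
    ultimately show ?thesis by simp
  qed
  then have "poly (pCons 0 (r - map_poly of_real q)) w = 0" for w by (cases "w = 0") auto
  then have "pCons 0 (r - map_poly of_real q) = 0" using poly_all_0_iff_0 by blast
  then show "r = map_poly of_real q" by simp
qed

section \<open>The functions of the second kind\<close>

lemma second_kind_measurable: "k \<le> p \<Longrightarrow> second_kind p \<sigma> n k \<in> borel_measurable borel"
proof (induction k)
  case 0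
  show ?case by simp
next
  case (Suc k)
  then show ?case using cauchy_measurable[of k "second_kind p \<sigma> n k"] by simp
qed

definition density_transform :: "nat \<Rightarrow> real poly \<Rightarrow> nat \<Rightarrow> real \<Rightarrow> real" where
  "density_transform l q k x = (\<integral>u. density l q k u / (x - u) \<partial>\<nu> k)"

lemma psi_Suc_density_transform:
  "psi l q (Suc k) x = (if k < l then 1 else x) * density_transform l q k x"
  unfolding density_transform_def by (rule psi_Suc)

lemma density_transform_regular:
  assumes "Suc k < p"
  shows "density_transform l q k \<in> borel_measurable borel"
    "continuous_on {a (Suc k)..b (Suc k)} (density_transform l q k)"
  unfolding density_transform_def
  using assms density_measurable density_continuous disjoint_intervals[of k]
  by (auto intro!: interval_measure.borel_measurable_cauchy_transform[OF interval_measure]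
      interval_measure.continuous_on_cauchy_transform[OF interval_measure])

text \<open>The recursion on the star is the recursion for \<open>psi\<close>, apart from a power of \<open>z\<close> that is determined by
the behaviour under rotations. Stating this for the transform of the density instead of \<open>psi\<close> keeps
the exponent of \<open>z\<close> nonnegative, so that the formula also holds at \<open>z = 0\<close>.\<close>

lemma second_kind_Suc:
  assumes q: "reduced_orthogonal n q" and l: "l = n mod (p + 1)"
  shows "k < p \<Longrightarrow> z ^ (p + 1) = of_real x \<Longrightarrow> x \<notin> {a k..b k} \<Longrightarrow>
    second_kind p \<sigma> n (Suc k) z =
      z ^ (if k < l then l - Suc k else p + l - k) * of_real (density_transform l q k x)"
proof (induction k arbitrary: z x)
  case 0
  interpret invariant_star_measure "\<sigma> 0" p "a 0" "b 0" using 0 by (intro invariant_star_measure)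
  have sk: "second_kind p \<sigma> n 0 t = t ^ l * of_real (poly q (star_coord p t))"
    if "t ^ (p + 1) = of_real (star_coord p t)" for t
    using mop_eq[OF q] poly_star_lift[of l q t] that by (simp add: l poly_map_poly_of_real del: power_Suc)
  have "second_kind p \<sigma> n (Suc 0) z = (\<integral>t. second_kind p \<sigma> n 0 t / (z - t) \<partial>\<sigma> 0)" by simp
  also have "\<dots> = (\<integral>t. t ^ l * of_real (poly q (star_coord p t)) / (z - t) \<partial>\<sigma> 0)"
  proof (rule integral_cong_AE)
    show "AE t in \<sigma> 0. second_kind p \<sigma> n 0 t / (z - t) = t ^ l * of_real (poly q (star_coord p t)) / (z - t)"
      using AE_star[OF 0(1)] by eventually_elim (use sk in metis)
  qed (use second_kind_measurable[of 0] in measurable)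
  also have "\<dots> = z ^ (if 0 < l then l - Suc 0 else p + l - 0) * of_real (density_transform l q 0 x)"
  proof (cases "0 < l")
    case True
    have "l \<le> p" by (simp add: l less_Suc_eq_le[symmetric])
    then have e: "l + (p + 1 - l) = p + 1" "p - (p + 1 - l) = l - 1" using True by auto
    show ?thesis
      using True cauchy_transform_star_coord[of "poly q" z x "p + 1 - l" l] 0 e
      by (simp add: density_transform_def density_def \<nu>_def continuous_intros)
  next
    case False
    then show ?thesis
      using cauchy_transform_star_coord[of "poly q" z x 0 l] 0
      by (simp add: density_transform_def density_def \<nu>_def continuous_intros)
  qed
  finally show ?case .
next
  case (Suc k)
  have k: "k < p" "Suc k < p" using Suc.prems(1) by auto
  interpret invariant_star_measure "\<sigma> (Suc k)" p "a (Suc k)" "b (Suc k)" using k by (intro invariant_star_measure)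
  have lp: "l \<le> p" by (simp add: l less_Suc_eq_le[symmetric])
  let ?e = "if k < l then l - Suc k else p + l - k"
  note [measurable] = density_transform_regular(1)[OF k(2), of l q]
  have [measurable]: "second_kind p \<sigma> n (Suc k) \<in> borel_measurable borel"
    by (rule second_kind_measurable) (use k in simp)
  have "second_kind p \<sigma> n (Suc (Suc k)) z = (\<integral>t. second_kind p \<sigma> n (Suc k) t / (z - t) \<partial>\<sigma> (Suc k))"
    by simp
  also have "\<dots> = (\<integral>t. t ^ ?e * of_real (density_transform l q k (star_coord p t)) / (z - t) \<partial>\<sigma> (Suc k))"
  proof (rule integral_cong_AE)
    show "AE t in \<sigma> (Suc k). second_kind p \<sigma> n (Suc k) t / (z - t) =
        t ^ ?e * of_real (density_transform l q k (star_coord p t)) / (z - t)"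
      using AE_star[OF k(2)]
    proof eventually_elim
      case (elim t)
      then have "star_coord p t \<notin> {a k..b k}" using disjoint_intervals[OF k(2)] by blast
      then show ?case using Suc.IH[OF k(1), of t "star_coord p t"] elim by simp
    qed
  qed measurable
  also have "\<dots> = z ^ (if Suc k < l then l - Suc (Suc k) else p + l - Suc k) * of_real (density_transform l q (Suc k) x)"
  proof -
    \<comment> \<open>the exponent of the only term of the geometric sum that survives the rotation average\<close>
    define i where "i = (if k < l \<and> l \<noteq> Suc k then Suc p - (l - Suc k) else Suc k - l)"
    have i: "i \<le> p" "(p + 1) dvd (?e + i)" "p - i = (if Suc k < l then l - Suc (Suc k) else p + l - Suc k)"
      and density: "density l q (Suc k) u = u ^ ((?e + i) div (p + 1)) * density_transform l q k u" for u
      using k lp psi_Suc_density_transform[of l q k u]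
      by (cases "l = Suc k"; cases "k < l"; auto simp: i_def density_def simp del: psi.simps)+
    show ?thesis
      using cauchy_transform_star_coord[of "density_transform l q k" z x i ?e] density_transform_regular[OF k(2)] Suc.prems i
      unfolding density_transform_def[of l q "Suc k"] density \<nu>_def by simp
  qed
  finally show ?case .
qed

lemma second_kind_density:
  assumes q: "reduced_orthogonal n q" and l: "l = n mod (p + 1)"
    and k: "k < p" and t: "t ^ (p + 1) = of_real x" "x \<in> {a k..b k}"
  shows "second_kind p \<sigma> n k t * t ^ (if l < Suc k then k - l else p + Suc k - l) = of_real (density l q k x)"
proof (cases k)
  case 0
  have "l \<le> p" by (simp add: l less_Suc_eq_le[symmetric])
  moreover have sk: "second_kind p \<sigma> n 0 t = t ^ l * of_real (poly q x)"
    using mop_eq[OF q] poly_star_lift[of l q t] t by (simp add: l poly_map_poly_of_real del: power_Suc)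
  moreover have "t ^ l * of_real (poly q x) * t ^ (p + 1 - l) = t ^ (p + 1) * of_real (poly q x)" if "l \<le> p"
    using that by (simp flip: power_add add: ac_simps del: power_Suc)
  ultimately show ?thesis using 0 t(1) by (auto simp: density_def simp del: power_Suc)
next
  case (Suc j)
  have j: "j < p" "Suc j < p" using k Suc by auto
  have lp: "l \<le> p" by (simp add: l less_Suc_eq_le[symmetric])
  let ?e = "if j < l then l - Suc j else p + l - j"
  let ?f = "if l < Suc k then k - l else p + Suc k - l"
  have "x \<notin> {a j..b j}" using disjoint_intervals[OF j(2)] t(2) Suc by blast
  then have "second_kind p \<sigma> n k t = t ^ ?e * of_real (density_transform l q j x)"
    using second_kind_Suc[OF q l j(1) t(1)] Suc by simp
  then have "second_kind p \<sigma> n k t * t ^ ?f = t ^ (?e + ?f) * of_real (density_transform l q j x)"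
    by (simp add: power_add)
  moreover have "?e + ?f = (if l = k then 0 else p + 1)" using lp k Suc by auto
  ultimately have "second_kind p \<sigma> n k t * t ^ ?f = (if l = k then 1 else of_real x) * of_real (density_transform l q j x)"
    using t(1) by (simp del: power_Suc)
  also have "\<dots> = of_real (density l q k x)"
    using Suc by (auto simp: density_def psi_Suc_density_transform simp del: psi.simps)
  finally show ?thesis .
qed

lemma reduced_second_kind_eq:
  assumes q: "reduced_orthogonal n q" and l: "l = n mod (p + 1)"
    and k: "k < p" and x: "x \<in> {a k<..<b k}"
  shows "reduced_second_kind p \<sigma> n k (of_real x) = of_real (psi l q k x)"
proof (cases k)
  case 0
  then show ?thesis using reduced_mop_eq[OF q] by (simp add: reduced_second_kind_def poly_map_poly_of_real)
next
  case (Suc j)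
  have j: "j < p" using k Suc by simp
  interpret invariant_star_measure "\<sigma> j" p "a j" "b j" using j by (intro invariant_star_measure)
  let ?f = "if l < Suc j then j - l else p + Suc j - l"
  have [measurable]: "density l q j \<in> borel_measurable borel" "second_kind p \<sigma> n j \<in> borel_measurable borel"
    using density_measurable second_kind_measurable j by auto
  have "(\<integral>t. second_kind p \<sigma> n j t * t ^ ?f / (of_real x - t ^ (p + 1)) \<partial>\<sigma> j) =
      (\<integral>t. t ^ 0 * of_real (density l q j (star_coord p t) / (x - star_coord p t)) \<partial>\<sigma> j)"
  proof (rule integral_cong_AE)
    show "AE t in \<sigma> j. second_kind p \<sigma> n j t * t ^ ?f / (of_real x - t ^ (p + 1)) =
        t ^ 0 * of_real (density l q j (star_coord p t) / (x - star_coord p t))"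
      using AE_star[OF j]
    proof eventually_elim
      case (elim t)
      have "second_kind p \<sigma> n j t * t ^ ?f = of_real (density l q j (star_coord p t))"
        using elim by (intro second_kind_density[OF q l j]) auto
      then show ?case using elim by (simp only: of_real_divide of_real_diff power_0 mult_1_left)
    qed
  qed measurable
  also have "\<dots> = (\<integral>u. of_real (density l q j u / (x - u)) \<partial>\<nu> j)"
  proof -
    have "(\<lambda>u. complex_of_real (density l q j u / (x - u))) \<in> borel_measurable borel" by measurable
    from integral_power_times_star_coord[OF this, of 0] show ?thesis unfolding \<nu>_def[symmetric] by simp
  qed
  also have "\<dots> = of_real (density_transform l q j x)"
    unfolding density_transform_def by (rule integral_complex_of_real)
  finally have "(\<integral>t. second_kind p \<sigma> n j t * t ^ ?f / (of_real x - t ^ (p + 1)) \<partial>\<sigma> j) =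
      of_real (density_transform l q j x)" .
  then show ?thesis
    unfolding reduced_second_kind_def Let_def l[symmetric] Suc psi_Suc_density_transform
    by (cases "l < Suc j") (simp_all del: power_Suc)
qed

lemma zero_poly_root_iff:
  assumes q: "reduced_orthogonal n q" and l: "l = n mod (p + 1)" and k: "k < p"
  shows "poly (zero_poly p a b \<sigma> n k) x = 0 \<longleftrightarrow> x \<in> zeros l q k"
proof -
  have eq: "{x. a k < x \<and> x < b k \<and> reduced_second_kind p \<sigma> n k (of_real x) = 0} = zeros l q k"
    using reduced_second_kind_eq[OF q l k] by (auto simp: zeros_def)
  have "l \<le> p" by (simp add: l less_Suc_eq_le[symmetric])
  moreover have "q \<noteq> 0" using q by (auto simp: reduced_orthogonal_def)
  ultimately have "finite (zeros l q k)"
    using q k finite_zeros unfolding reduced_orthogonal_def l[symmetric] by blast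
  then show ?thesis unfolding zero_poly_def eq by (auto simp: poly_prod)
qed

section \<open>Interlacing\<close>

text \<open>All members of the pencil have degree at most \<open>Suc D\<close> and satisfy the conditions of a window of length
\<open>D\<close>, so \<open>zero_between_zeros\<close> applies in both directions.\<close>

lemma zeros_interlace_common:
  assumes "l \<le> p" "k < p" "orth l D q1" "orth l D q2" "lead_coeff q1 = 1" "lead_coeff q2 = 1"
    "degree q1 = Suc D" "degree q2 = Suc D" "q1 \<noteq> q2"
    and roots: "\<And>x. poly P x = 0 \<longleftrightarrow> x \<in> zeros l q1 k" "\<And>x. poly R x = 0 \<longleftrightarrow> x \<in> zeros l q2 k"
  shows "zeros_interlace P R"
proof (rule zeros_interlaceI)
  fix x y :: real
  show "\<exists>z. x < z \<and> z < y \<and> poly R z = 0" if "poly P x = 0" "poly P y = 0" "x < y"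
    using zero_between_zeros[of l D q1 q2 k x y] monic_independent[of q1 q2] assms that by auto
  show "\<exists>z. x < z \<and> z < y \<and> poly P z = 0" if "poly R x = 0" "poly R y = 0" "x < y"
    using zero_between_zeros[of l D q2 q1 k x y] monic_independent[of q2 q1] assms that by auto
qed

end

theorem theorem3p1:
  fixes p n k :: nat
    and a b :: "nat \<Rightarrow> real"
    and \<sigma> :: "nat \<Rightarrow> complex measure"
  assumes "p \<ge> 1"
    and "nikishin_generators p a b \<sigma>"
    and "k < p"
  shows "zeros_interlace (zero_poly p a b \<sigma> n k) (zero_poly p a b \<sigma> (n + 1) k)"
proof -
  interpret star_nikishin p a b \<sigma> using assms by unfold_locales
  note k = \<open>k < p\<close>
  define l d where "l = n mod (p + 1)" and "d = n div (p + 1)"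
  have lp: "l \<le> p" by (simp add: l_def less_Suc_eq_le[symmetric])
  obtain q r where q: "reduced_orthogonal n q" and r: "reduced_orthogonal (n + 1) r"
    using reduced_orthogonal_exists by metis
  have qd: "lead_coeff q = 1" "degree q = d" "orth l d q"
    using q by (auto simp: reduced_orthogonal_def l_def d_def)
  have q0: "q \<noteq> 0" using qd(1) by auto
  note rootsP = zero_poly_root_iff[OF q l_def k]
  \<comment> \<open>for \<open>d = 0\<close> and \<open>l < p\<close> there are no zeros at all; the shift of \<open>l\<close> needs a nonempty window\<close>
  consider "l < p" "d = 0" | d' where "l < p" "d = Suc d'" | "l = p" using lp not0_implies_Suc by fastforce
  then show ?thesis
  proof cases
    case 1
    then have n1: "(n + 1) mod (p + 1) = Suc l" "(n + 1) div (p + 1) = 0"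
      unfolding l_def d_def by (auto simp: mod_Suc div_Suc)
    have rd: "degree r = 0" "r \<noteq> 0" "orth (Suc l) 0 r" using r n1 by (auto simp: reduced_orthogonal_def)
    have "zeros l q k = {}" using zeros_bound[OF qd(3) lp q0 k] qd 1 by auto
    moreover have "zeros (Suc l) r k = {}" using zeros_bound[OF rd(3) _ rd(2) k] rd 1 by auto
    ultimately show ?thesis
      using rootsP zero_poly_root_iff[OF r n1(1)[symmetric] k] by (intro zeros_interlaceI) auto
  next
    case 2
    then have n1: "(n + 1) mod (p + 1) = Suc l" "(n + 1) div (p + 1) = d"
      unfolding l_def d_def by (auto simp: mod_Suc div_Suc)
    have rd: "lead_coeff r = 1" "degree r = d" "orth (Suc l) d r" using r n1 by (auto simp: reduced_orthogonal_def)
    \<comment> \<open>otherwise \<open>q\<close> would satisfy the conditions of both windows, which are one more than its degree\<close>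
    have ne: "q \<noteq> r"
    proof
      assume eq: "q = r"
      have "orth l (Suc d) q" unfolding orth_def
      proof (intro allI impI)
        fix m assume "l \<le> m \<and> m < l + Suc d"
        then consider "l \<le> m \<and> m < l + d" | "Suc l \<le> m \<and> m < Suc l + d" using 2 by linarith
        then show "(\<integral>t. poly q t * t ^ (m div p) * weight (m mod p) 0 t \<partial>\<nu> 0) = 0"
          using qd(3) rd(3) unfolding eq orth_def by cases blast+
      qed
      then show False using degree_lower_bound[OF _ lp q0] qd(2) by fastforce
    qed
    have "zeros l q k = zeros (Suc l) q k"
      using psi_shift[OF qd(3) _ 2(1) k] 2(2) by (auto simp: zeros_def)
    then show ?thesis
      using qd rd ne 2 k rootsP zero_poly_root_iff[OF r n1(1)[symmetric] k]
      by (intro zeros_interlace_common[of "Suc l" k d' q r])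
        (auto intro: orth_subwindow[of l d q] orth_subwindow[of "Suc l" d r])
  next
    case 3
    then have n1: "(n + 1) mod (p + 1) = 0" "(n + 1) div (p + 1) = Suc d"
      unfolding l_def d_def by (auto simp: mod_Suc div_Suc)
    have rd: "lead_coeff r = 1" "degree r = Suc d" "orth 0 (Suc d) r" using r n1 by (auto simp: reduced_orthogonal_def)
    \<comment> \<open>otherwise \<open>q\<close> would satisfy one condition more than its degree\<close>
    have ne: "pCons 0 q \<noteq> r"
    proof
      assume "pCons 0 q = r"
      then have "orth p (Suc d) q" using rd(3) orth_times_variable[of "Suc d" q] by simp
      then show False using degree_lower_bound[OF _ order_refl q0] qd(2) by fastforce
    qed
    have "zeros 0 (pCons 0 q) k = zeros l q k"
      using psi_times_variable[of k q] k zero_notin_interior[OF k] 3 unfolding zeros_def by auto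
    then show ?thesis
      using qd rd ne 3 k q0 rootsP zero_poly_root_iff[OF r n1(1)[symmetric] k] orth_times_variable[of d q]
      by (intro zeros_interlace_common[of 0 k d "pCons 0 q" r])
        (auto intro: orth_subwindow[of 0 "Suc d" r])
  qed
qed

end
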